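(* For every sequence $\bm\alpha=(\alpha_i)_{i<\omega}$ of ordinals, $v(G(\bm\alpha))=\#^{S}_{i<\omega}\alpha_i$, where $v(G(\bm\alpha))$ is the value of the combinatorial game $G(\bm\alpha)$ associated to $\bm\alpha$.
   Context: Notation. $+$ is the usual ordinal sum, $\#$ (binary or finitary) is the Hessenberg natural sum of ordinals, and $\otimes$ is the natural product of ordinals: $\omega^{\xi}\otimes\omega^{\rho}=\omega^{\xi\#\rho}$, extended to arbitrary ordinals in normal form by distributivity over $\#$, with $\alpha\otimes 0=0\otimes\alpha=0$. The ordinal $0$ is neither limit nor successor. Every nonzero ordinal $\zeta$ is uniquely written in (additive) normal form $\zeta=\omega^{\xi_s}+\dots+\omega^{\xi_1}+\omega^{\xi_0}$ with $\xi_s\ge\dots\ge\xi_0$; put $\hat\zeta=\omega^{\xi_s}+\dots+\omega^{\xi_1}$ (last summand removed; $\hat\zeta=0$ if there is only one summand). For a sequence $\bm\alpha=(\alpha_i)_{i<\omega}$ of ordinals, let $\varepsilon_{\bm\alpha}$ be the least ordinal $\varepsilon$ such that $\{i<\omega:\varepsilon\le\alpha_i\}$ is finite, and let $\zeta_{\bm\alpha}$ be the least ordinal $\zeta$ such that $\{i<\omega:\zeta<\alpha_i\}$ is finite. The element $\alpha_i$ (for the index $i$) is e-special if $\alpha_i\ge\varepsilon_{\bm\alpha}$. One always has $\zeta_{\bm\alpha}\le\varepsilon_{\bm\alpha}$. Definition of $\#^{S}$. Let $i_1,\dots,i_h$ enumerate the finite (possibly empty) set of indices of e-special elements of $\bm\alpha$.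 Let $\alpha_{i_p}^{\heartsuit}$ be the unique ordinal with $\zeta_{\bm\alpha}+\alpha_{i_p}^{\heartsuit}=\alpha_{i_p}$ and, if $\zeta_{\bm\alpha}>0$, let $\alpha_{i_p}^{\diamondsuit}$ be the unique ordinal with $\hat\zeta_{\bm\alpha}+\alpha_{i_p}^{\diamondsuit}=\alpha_{i_p}$. If $\zeta_{\bm\alpha}>0$, let $\omega^{\xi_0}$ be the last summand in the normal form of $\zeta_{\bm\alpha}$. (S1) If $\zeta_{\bm\alpha}>0$, $\xi_0$ is a limit ordinal, and only finitely many elements of $\bm\alpha$ are $\ge\zeta_{\bm\alpha}$ (i.e. $\zeta_{\bm\alpha}=\varepsilon_{\bm\alpha}$), then $\#^{S}_{i<\omega}\alpha_i=(\hat\zeta_{\bm\alpha}\otimes\omega)\,\#\,\omega^{\xi_0}\,\#\,\alpha_{i_1}^{\diamondsuit}\,\#\cdots\#\,\alpha_{i_h}^{\diamondsuit}$. (S2) Otherwise (including the case $\zeta_{\bm\alpha}=0$), $\#^{S}_{i<\omega}\alpha_i=(\zeta_{\bm\alpha}\otimes\omega)\,\#\,\alpha_{i_1}^{\heartsuit}\,\#\cdots\#\,\alpha_{i_h}^{\heartsuit}$. The game $G(\bm\alpha)$. A Left move on $G(\bm\alpha)$ consists of choosing some $\bar\imath<\omega$, some finite, possibly empty, $F\subseteq\omega$ with $\bar\imath\notin F$, and some ordinal $\beta<\alpha_{\bar\imath}$ (so no move is possible if all $\alpha_i=0$). The outcome is the game $G(\bm\beta)$, where $\beta_i=\alpha_i$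 if $i\in F$ or $\alpha_i\le\beta$, and $\beta_i=\beta$ otherwise. The Right player never has available moves. No infinite run is possible, so $G(\bm\alpha)$ is a combinatorial game. Its value $v(G(\bm\alpha))$ is its class modulo Conway equivalence; since only Left has moves in every subposition, this value is an ordinal, namely the smallest ordinal strictly larger than the values $v(G(\bm\beta))$ of all the games $G(\bm\beta)$ which Left can reach by one move on $G(\bm\alpha)$. *)

theory Defs
  imports "HOL-Library.Multiset"
begin

unbundle cardinal_syntax

text \<open>
  HOL has no single type of all ordinals.  The type below consists of the order types of the
  well-orders whose field is a set of elements of the infinite type \<open>'a + nat\<close>, that is, of all
  ordinals smaller than the successor cardinal of \<open>'a + nat\<close>.  As \<open>'a\<close> is arbitrary, every set of
  ordinals is covered by a suitable instance.  Each instance is an uncountable regular cardinal, so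
  it is closed under countable suprema and under all the operations below; in particular every
  \<open>LEAST\<close> below is taken over a nonempty set.
\<close>

quotient_type 'a ordinal = "('a + nat) rel" / partial: "\<lambda>r s. r =o s"
proof (rule part_equivpI)
  have "Well_order ({} :: ('a + nat) rel)" by simp
  then show "\<exists>r :: ('a + nat) rel. r =o r" using ordIso_reflexive by blast
  show "symp (\<lambda>r s :: ('a + nat) rel. r =o s)" by (rule sympI) (rule ordIso_symmetric)
  show "transp (\<lambda>r s :: ('a + nat) rel. r =o s)" by (rule transpI) (rule ordIso_transitive)
qed

instantiation ordinal :: (type) linorder
begin

lift_definition less_eq_ordinal :: "'a ordinal \<Rightarrow> 'a ordinal \<Rightarrow> bool" is "\<lambda>r s. r \<le>o s"
  by (meson ordIso_symmetric ordIso_ordLeq_trans ordLeq_ordIso_trans)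

lift_definition less_ordinal :: "'a ordinal \<Rightarrow> 'a ordinal \<Rightarrow> bool" is "\<lambda>r s. r <o s"
  by (meson ordIso_symmetric ordIso_ordLess_trans ordLess_ordIso_trans)

instance
proof
  fix x y z :: "'a ordinal"
  show "x < y \<longleftrightarrow> x \<le> y \<and> \<not> y \<le> x"
  proof transfer
    fix x y :: "('a + nat) rel"
    assume "x =o x" "y =o y"
    then have "Well_order x" "Well_order y"
      using ordIso_imp_ordLeq ordLeq_Well_order_simp by blast+
    then show "x <o y \<longleftrightarrow> x \<le>o y \<and> \<not> y \<le>o x"
      using not_ordLeq_iff_ordLess ordLess_imp_ordLeq by blast
  qed
  show "x \<le> x"
    by transfer (rule ordIso_imp_ordLeq)
  show "x \<le> z" if "x \<le> y" "y \<le> z" using that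
    by transfer (rule ordLeq_transitive)
  show "x = y" if "x \<le> y" "y \<le> x" using that
    by transfer (simp add: ordIso_iff_ordLeq)
  show "x \<le> y \<or> y \<le> x"
    by transfer (meson ordLeq_total ordIso_imp_ordLeq ordLeq_Well_order_simp)
qed

end

instance ordinal :: (type) wellorder
proof
  fix P :: "'a ordinal \<Rightarrow> bool" and a
  assume step: "\<And>x. (\<And>y. y < x \<Longrightarrow> P y) \<Longrightarrow> P x"
  have "wf (inv_image ordLess (rep_ordinal :: 'a ordinal \<Rightarrow> _))"
    by (rule wf_inv_image[OF wf_ordLess])
  then show "P a"
    by (induction a rule: wf_induct_rule)
      (rule step, simp add: less_ordinal_def inv_image_def)
qed

unbundle no cardinal_syntax

instantiation ordinal :: (type) "{zero, one}"
begin

lift_definition zero_ordinal :: "'a ordinal" is "{}"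
  by (rule ordIso_reflexive) simp

definition one_ordinal :: "'a ordinal" where
  "one_ordinal = (LEAST x. 0 < x)"

instance ..

end

text \<open>
  Ordinal sum, ordinal product and powers of \<open>\<omega>\<close>.  In each case one clause treats zero, successor
  and limit values of the recursion argument uniformly.
\<close>

instantiation ordinal :: (type) "{plus, times}"
begin

function plus_ordinal :: "'a ordinal \<Rightarrow> 'a ordinal \<Rightarrow> 'a ordinal" where
  "plus_ordinal a b = (LEAST c. a \<le> c \<and> (\<forall>y\<in>{..<b}. plus_ordinal a y < c))"
  by pat_completeness auto
termination
proof (relation "inv_image {(x, y). x < y} snd")
  show "wf (inv_image {(x, y :: 'a ordinal). x < y} snd)" by (rule wf_inv_image[OF wf])
qed simp

declare plus_ordinal.simps [simp del]

function times_ordinal :: "'a ordinal \<Rightarrow> 'a ordinal \<Rightarrow> 'a ordinal" where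
  "times_ordinal a b = (LEAST c. \<forall>y\<in>{..<b}. times_ordinal a y + a \<le> c)"
  by pat_completeness auto
termination
proof (relation "inv_image {(x, y). x < y} snd")
  show "wf (inv_image {(x, y :: 'a ordinal). x < y} snd)" by (rule wf_inv_image[OF wf])
qed simp

declare times_ordinal.simps [simp del]

instance ..

end

definition is_limit :: "'a ordinal \<Rightarrow> bool" where
  "is_limit a \<longleftrightarrow> a \<noteq> 0 \<and> (\<nexists>b. a = b + 1)"

definition omega :: "'a ordinal" (\<open>\<omega>\<close>) where
  "\<omega> = (LEAST a. is_limit a)"

function omega_pow :: "'a ordinal \<Rightarrow> 'a ordinal" where
  "omega_pow b = (LEAST c. 1 \<le> c \<and> (\<forall>y\<in>{..<b}. omega_pow y * \<omega> \<le> c))"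
  by pat_completeness auto
termination
  by (relation "{(x, y). x < y}") (simp_all add: wf)

declare omega_pow.simps [simp del]

text \<open>
  A normal form \<open>\<omega>\<^bsup>\<xi>\<^sub>s\<^esup> + \<dots> + \<omega>\<^bsup>\<xi>\<^sub>0\<^esup>\<close> with \<open>\<xi>\<^sub>s \<ge> \<dots> \<ge> \<xi>\<^sub>0\<close> is represented by the multiset of its
  exponents, and the ordinal \<open>0\<close> by the empty multiset.
\<close>

definition of_cnf :: "'a ordinal multiset \<Rightarrow> 'a ordinal" where
  "of_cnf M = foldr (+) (map omega_pow (rev (sorted_list_of_multiset M))) 0"

definition cnf :: "'a ordinal \<Rightarrow> 'a ordinal multiset" where
  "cnf a = (THE M. of_cnf M = a)"

definition nat_add :: "'a ordinal \<Rightarrow> 'a ordinal \<Rightarrow> 'a ordinal" (infixl \<open>\<oplus>\<close> 65) where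
  "a \<oplus> b = of_cnf (cnf a + cnf b)"

definition nat_sum :: "('i \<Rightarrow> 'a ordinal) \<Rightarrow> 'i set \<Rightarrow> 'a ordinal" where
  "nat_sum f I = of_cnf (\<Sum>i\<in>I. cnf (f i))"

definition nat_mult :: "'a ordinal \<Rightarrow> 'a ordinal \<Rightarrow> 'a ordinal" (infixl \<open>\<otimes>\<close> 70) where
  "a \<otimes> b = of_cnf (\<Sum>\<xi>\<in>#cnf a. {#\<xi> \<oplus> \<rho>. \<rho> \<in># cnf b#})"

definition last_exponent :: "'a ordinal \<Rightarrow> 'a ordinal" where
  "last_exponent a = Min (set_mset (cnf a))"

definition drop_last :: "'a ordinal \<Rightarrow> 'a ordinal" where
  "drop_last a = of_cnf (cnf a - {#last_exponent a#})"

text \<open>The unique \<open>x\<close> with \<open>c + x = a\<close>, which exists if \<open>c \<le> a\<close>.\<close>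

definition left_diff :: "'a ordinal \<Rightarrow> 'a ordinal \<Rightarrow> 'a ordinal" where
  "left_diff c a = (THE x. c + x = a)"

definition seq_eps :: "(nat \<Rightarrow> 'a ordinal) \<Rightarrow> 'a ordinal" where
  "seq_eps \<alpha> = (LEAST e. finite {i. e \<le> \<alpha> i})"

definition seq_zeta :: "(nat \<Rightarrow> 'a ordinal) \<Rightarrow> 'a ordinal" where
  "seq_zeta \<alpha> = (LEAST z. finite {i. z < \<alpha> i})"

definition e_special :: "(nat \<Rightarrow> 'a ordinal) \<Rightarrow> nat set" where
  "e_special \<alpha> = {i. seq_eps \<alpha> \<le> \<alpha> i}"

definition sum_S :: "(nat \<Rightarrow> 'a ordinal) \<Rightarrow> 'a ordinal" where
  "sum_S \<alpha> =
    (let \<zeta> = seq_zeta \<alpha>; \<xi>\<^sub>0 = last_exponent \<zeta> in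
     if 0 < \<zeta> \<and> is_limit \<xi>\<^sub>0 \<and> finite {i. \<zeta> \<le> \<alpha> i}
     then (drop_last \<zeta> \<otimes> \<omega>) \<oplus> omega_pow \<xi>\<^sub>0
            \<oplus> nat_sum (\<lambda>i. left_diff (drop_last \<zeta>) (\<alpha> i)) (e_special \<alpha>)
     else (\<zeta> \<otimes> \<omega>) \<oplus> nat_sum (\<lambda>i. left_diff \<zeta> (\<alpha> i)) (e_special \<alpha>))"

text \<open>
  A ruleset gives the Left and Right options of every position; a combinatorial game is a position
  of a ruleset from which no infinite run is possible.
\<close>

record 'p ruleset =
  left_moves :: "'p \<Rightarrow> 'p set"
  right_moves :: "'p \<Rightarrow> 'p set"

definition no_infinite_run :: "'p ruleset \<Rightarrow> bool" where
  "no_infinite_run G \<longleftrightarrow> wf {(p', p). p' \<in> left_moves G p \<union> right_moves G p}"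

text \<open>
  Conway's order between a game \<open>p\<close> of the ruleset \<open>G\<close> and a game \<open>q\<close> of the ruleset \<open>H\<close>:
  \<open>conway_le\<close> is \<open>p \<le> q\<close>, that is, no left option of \<open>p\<close> is \<open>\<ge> q\<close> and no right option of \<open>q\<close> is
  \<open>\<le> p\<close>.  To have a monotone definition, it is stated together with the negation \<open>conway_lf\<close> of
  \<open>p \<ge> q\<close>; see \<open>conway_lf_iff\<close> below.
\<close>

inductive conway_le :: "'p ruleset \<Rightarrow> 'q ruleset \<Rightarrow> 'p \<Rightarrow> 'q \<Rightarrow> bool"
  and conway_lf :: "'p ruleset \<Rightarrow> 'q ruleset \<Rightarrow> 'p \<Rightarrow> 'q \<Rightarrow> bool"
  for G :: "'p ruleset" and H :: "'q ruleset"
where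
  le: "(\<forall>p'\<in>left_moves G p. conway_lf G H p' q) \<Longrightarrow>
       (\<forall>q'\<in>right_moves H q. conway_lf G H p q') \<Longrightarrow> conway_le G H p q"
| lf_left: "q' \<in> left_moves H q \<Longrightarrow> conway_le G H p q' \<Longrightarrow> conway_lf G H p q"
| lf_right: "p' \<in> right_moves G p \<Longrightarrow> conway_le G H p' q \<Longrightarrow> conway_lf G H p q"

lemma conway_lf_iff:
  assumes "no_infinite_run G" "no_infinite_run H"
  shows "conway_lf G H p q \<longleftrightarrow> \<not> conway_le H G q p"
    and "conway_lf H G q p \<longleftrightarrow> \<not> conway_le G H p q"
proof -
  let ?R = "{(p', p). p' \<in> left_moves G p \<union> right_moves G p}"
  let ?S = "{(q', q). q' \<in> left_moves H q \<union> right_moves H q}"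
  have "wf (?R <*lex*> ?S)"
    using assms by (auto simp: no_infinite_run_def)
  have "(conway_lf G H p q \<longleftrightarrow> \<not> conway_le H G q p) \<and> (conway_lf H G q p \<longleftrightarrow> \<not> conway_le G H p q)"
    using \<open>wf (?R <*lex*> ?S)\<close>
  proof (induction "(p, q)" arbitrary: p q rule: wf_induct_rule)
    case less
    have G: "(conway_lf G H p' q \<longleftrightarrow> \<not> conway_le H G q p') \<and>
        (conway_lf H G q p' \<longleftrightarrow> \<not> conway_le G H p' q)"
      if "p' \<in> left_moves G p \<union> right_moves G p" for p'
      using less[of p' q] that by auto
    have H: "(conway_lf G H p q' \<longleftrightarrow> \<not> conway_le H G q' p) \<and>
        (conway_lf H G q' p \<longleftrightarrow> \<not> conway_le G H p q')"
      if "q' \<in> left_moves H q \<union> right_moves H q" for q'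
      using less[of p q'] that by auto
    show ?case
      unfolding conway_lf.simps[of G H p q] conway_lf.simps[of H G q p]
        conway_le.simps[of G H p q] conway_le.simps[of H G q p]
      using G H by blast
  qed
  then show "conway_lf G H p q \<longleftrightarrow> \<not> conway_le H G q p"
    and "conway_lf H G q p \<longleftrightarrow> \<not> conway_le G H p q" by blast+
qed

definition conway_eq :: "'p ruleset \<Rightarrow> 'p \<Rightarrow> 'q ruleset \<Rightarrow> 'q \<Rightarrow> bool" where
  "conway_eq G p H q \<longleftrightarrow> conway_le G H p q \<and> conway_le H G q p"

text \<open>
  The ordinal \<open>\<gamma>\<close> is the game in which Left can move to any smaller ordinal.  The value of \<open>p\<close>, its
  class modulo Conway equivalence, is the ordinal \<open>\<gamma>\<close> if \<open>p\<close> is equivalent to this game.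
\<close>

definition ordinal_game :: "'a ordinal ruleset" where
  "ordinal_game = \<lparr>left_moves = (\<lambda>\<gamma>. {..<\<gamma>}), right_moves = (\<lambda>_. {})\<rparr>"

definition has_value :: "'p ruleset \<Rightarrow> 'p \<Rightarrow> 'a ordinal \<Rightarrow> bool" where
  "has_value G p \<gamma> \<longleftrightarrow> conway_eq G p ordinal_game \<gamma>"

lemma ordinal_game_moves [simp]:
  "left_moves ordinal_game \<gamma> = {..<\<gamma>}" "right_moves ordinal_game \<gamma> = {}"
  by (simp_all add: ordinal_game_def)

lemma no_infinite_run_ordinal_game: "no_infinite_run ordinal_game"
  by (simp add: no_infinite_run_def wf)

lemma ordinal_le_trans:
  fixes \<delta> \<gamma> :: "'a ordinal"
  assumes "no_infinite_run G"
  shows "(conway_le ordinal_game G \<delta> p \<longrightarrow> conway_le G ordinal_game p \<gamma> \<longrightarrow> \<delta> \<le> \<gamma>) \<and>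
    (conway_lf ordinal_game G \<delta> p \<longrightarrow> conway_le G ordinal_game p \<gamma> \<longrightarrow> \<delta> < \<gamma>) \<and>
    (conway_le ordinal_game G \<delta> p \<longrightarrow> conway_lf G ordinal_game p \<gamma> \<longrightarrow> \<delta> < \<gamma>)"
  using assms unfolding no_infinite_run_def
proof (induction p arbitrary: \<delta> \<gamma> rule: wf_induct_rule)
  case (less p)
  have 1: "\<delta> < \<gamma>"
    if lf: "conway_lf ordinal_game G \<delta> p" and le: "conway_le G ordinal_game p \<gamma>" for \<delta> \<gamma> :: "'a ordinal"
  proof -
    obtain p' where "p' \<in> left_moves G p" "conway_le ordinal_game G \<delta> p'"
      using lf by (auto elim: conway_lf.cases)
    moreover from this(1) have "conway_lf G ordinal_game p' \<gamma>"
      using le by (auto elim: conway_le.cases)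
    ultimately show ?thesis using less.IH[of p' \<delta> \<gamma>] by simp
  qed
  have 2: "\<delta> \<le> \<gamma>"
    if "conway_le ordinal_game G \<delta> p" "conway_le G ordinal_game p \<gamma>" for \<delta> \<gamma> :: "'a ordinal"
  proof (rule ccontr)
    assume "\<not> \<delta> \<le> \<gamma>"
    then have "conway_lf ordinal_game G \<gamma> p"
      using that(1) by (auto elim: conway_le.cases)
    then show False using 1[OF _ that(2)] by blast
  qed
  have 3: "\<delta> < \<gamma>"
    if *: "conway_le ordinal_game G \<delta> p" and "conway_lf G ordinal_game p \<gamma>" for \<delta> \<gamma> :: "'a ordinal"
    using that(2)
  proof cases
    case (lf_left \<gamma>')
    then show ?thesis using 2[OF *, of \<gamma>'] by simp
  next
    case (lf_right p')
    moreover have "conway_lf ordinal_game G \<delta> p'"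
      using * lf_right(1) by (auto elim: conway_le.cases)
    ultimately show ?thesis using less.IH[of p' \<delta> \<gamma>] by simp
  qed
  show ?case using 1[of \<delta> \<gamma>] 2[of \<delta> \<gamma>] 3[of \<delta> \<gamma>] by blast
qed

lemma has_value_unique:
  assumes "no_infinite_run G" "has_value G p \<gamma>" "has_value G p \<gamma>'"
  shows "\<gamma> = \<gamma>'"
proof (rule antisym)
  show "\<gamma> \<le> \<gamma>'" using assms ordinal_le_trans[of G \<gamma> p \<gamma>'] by (simp add: has_value_def conway_eq_def)
  show "\<gamma>' \<le> \<gamma>" using assms ordinal_le_trans[of G \<gamma>' p \<gamma>] by (simp add: has_value_def conway_eq_def)
qed

definition seq_game :: "(nat \<Rightarrow> 'a ordinal) ruleset" where
  "seq_game = \<lparr>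
     left_moves = (\<lambda>\<alpha>. {(\<lambda>j. if j \<in> F \<or> \<alpha> j \<le> b then \<alpha> j else b) | i F b.
                            finite F \<and> i \<notin> F \<and> b < \<alpha> i}),
     right_moves = (\<lambda>_. {})\<rparr>"

lemma no_infinite_run_seq_game: "no_infinite_run (seq_game :: (nat \<Rightarrow> 'a ordinal) ruleset)"
proof (rule ccontr)
  assume "\<not> ?thesis"
  then obtain f :: "nat \<Rightarrow> nat \<Rightarrow> 'a ordinal"
    where run: "\<And>n. f (Suc n) \<in> left_moves seq_game (f n) \<union> right_moves seq_game (f n)"
    unfolding no_infinite_run_def wf_iff_no_infinite_down_chain by blast
  have "\<exists>t. finite (fst (snd t)) \<and> fst t \<notin> fst (snd t) \<and> snd (snd t) < f n (fst t) \<and>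
      (\<forall>j. f (Suc n) j =
        (if j \<in> fst (snd t) \<or> f n j \<le> snd (snd t) then f n j else snd (snd t)))" for n
  proof -
    obtain i F b where "finite F" "i \<notin> F" "b < f n i"
        "f (Suc n) = (\<lambda>j. if j \<in> F \<or> f n j \<le> b then f n j else b)"
      using run[of n] unfolding seq_game_def ruleset.simps by blast
    then show ?thesis by (intro exI[of _ "(i, F, b)"], unfold fst_conv snd_conv) simp
  qed
  then have "\<forall>n. \<exists>t. finite (fst (snd t)) \<and> fst t \<notin> fst (snd t) \<and> snd (snd t) < f n (fst t) \<and>
      (\<forall>j. f (Suc n) j =
        (if j \<in> fst (snd t) \<or> f n j \<le> snd (snd t) then f n j else snd (snd t)))"
    by (rule allI)
  from choice[OF this] obtain t
    where t: "\<And>n. finite (fst (snd (t n))) \<and> fst (t n) \<notin> fst (snd (t n)) \<and>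
      snd (snd (t n)) < f n (fst (t n)) \<and>
      (\<forall>j. f (Suc n) j =
        (if j \<in> fst (snd (t n)) \<or> f n j \<le> snd (snd (t n)) then f n j else snd (snd (t n))))"
    by blast
  define i F b where "i n = fst (t n)" and "F n = fst (snd (t n))" and "b n = snd (snd (t n))" for n
  have fin: "finite (F n)" and i: "i n \<notin> F n" and b: "b n < f n (i n)"
    and f: "f (Suc n) j = (if j \<in> F n \<or> f n j \<le> b n then f n j else b n)" for n j
    using t[of n] by (simp_all add: i_def F_def b_def del: if_split)
  have least: "\<exists>m. \<forall>n. g m \<le> g n" for g :: "nat \<Rightarrow> 'a ordinal"
  proof -
    have "(LEAST x. x \<in> range g) \<in> range g" by (rule LeastI_ex) blast
    moreover have "(LEAST x. x \<in> range g) \<le> g n" for n by (rule Least_le) blast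
    ultimately show ?thesis by (metis rangeE)
  qed
  have dec: "f n j \<le> f m j" if "m \<le> n" for m n j
    using _ that by (rule lift_Suc_antimono_le[of "\<lambda>n. f n j" m n]) (auto simp: f)
  obtain n0 where n0: "\<And>n. b n0 \<le> b n" using least[of b] by blast
  have in_F: "i n \<in> F n0" if "n > n0" for n
  proof (rule ccontr)
    assume "i n \<notin> F n0"
    then have "f (Suc n0) (i n) \<le> b n0" by (simp add: f)
    moreover have "f n (i n) \<le> f (Suc n0) (i n)" using that by (intro dec) simp
    ultimately show False using b[of n] n0[of n] by simp
  qed
  have "\<exists>N. \<forall>n\<ge>N. f n j = f N j" for j
  proof -
    obtain N where "\<And>n. f N j \<le> f n j" using least[of "\<lambda>n. f n j"] by blast
    then have "f n j = f N j" if "N \<le> n" for n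
      using dec[OF that, of j] by (intro antisym)
    then show ?thesis by blast
  qed
  then obtain N where N: "\<And>j n. n \<ge> N j \<Longrightarrow> f n j = f (N j) j" by metis
  define n where "n = Suc n0 + (\<Sum>j\<in>F n0. N j)"
  have "i n \<in> F n0" by (rule in_F) (simp add: n_def)
  then have "N (i n) \<le> n"
    using member_le_sum[of "i n" "F n0" N] fin[of n0] by (simp add: n_def)
  then have "f (Suc n) (i n) = f n (i n)" using N[of "i n" n] N[of "i n" "Suc n"] by simp
  moreover have "f (Suc n) (i n) = b n" using i[of n] b[of n] by (auto simp: f)
  ultimately show False using b[of n] by simp
qed

end

theory Submission
  imports Defs "HOL-Library.Multiset_Order"
begin

text \<open>
  The value of a game in which only Left moves is the least ordinal above the values of its
  options.  So, by induction along the moves, it suffices that the sum strictly decreases with every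
  move (\<open>left_option_less\<close>) and that every \<open>c < sum_S \<alpha>\<close> satisfies \<open>c \<le> sum_S \<beta>\<close> for some option
  \<open>\<beta>\<close> of \<open>\<alpha>\<close> (\<open>reach_all\<close>).  The lemma \<open>has_value_if_mex\<close> is this principle.

  Both facts are proved in normal form.  The map \<open>of_cnf\<close> is an order isomorphism from finite
  multisets of ordinals, with the multiset order, onto the ordinals.  It turns the natural sum into
  the union of multisets and the product \<open>a \<otimes> \<omega>\<close> into adding \<open>1\<close> to each exponent, called
  \<open>shift\<close> below.  Hence \<open>sum_S \<alpha>\<close> becomes a main multiset, which depends only on
  \<open>\<zeta> = seq_zeta \<alpha>\<close> and on the case of the definition, plus one multiset for every special element
  (\<open>cnf_sum_S\<close>).

  A move that caps the sequence at some \<open>b \<ge> \<zeta>\<close> keeps the main multiset and lowers the contribution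
  of a special element.  A move that caps it at some \<open>b < \<zeta>\<close> with the finite exception set \<open>F\<close> makes
  \<open>b\<close> the new threshold, attained infinitely often, so the new sum is
  \<open>(b \<otimes> \<omega>) \<oplus> \<Sum>\<^sub>i (-b + \<alpha> i)\<close> with \<open>i\<close> ranging over the elements of \<open>F\<close> with \<open>b < \<alpha> i\<close>.

  To see that such a low move decreases the sum, write \<open>\<zeta>\<close> and \<open>b\<close> as a common part \<open>P\<close> followed by
  multisets with maximum \<open>q\<close> for \<open>\<zeta>\<close> and with all elements below \<open>q\<close> for \<open>b\<close>.  Up to the
  contributions that \<open>\<alpha>\<close> has as well, everything that the new sum has beside \<open>shift P\<close> consists of
  exponents \<open>\<le> q\<close>, and the main multiset of \<open>\<alpha>\<close> contains \<open>q + 1\<close> beside \<open>shift P\<close>.  The exception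
  is the case in which the last exponent \<open>\<xi>\<close> of \<open>\<zeta>\<close> is a limit, only finitely many elements are
  \<open>\<ge> \<zeta>\<close>, and \<open>q = \<xi>\<close> is all that is left of \<open>\<zeta>\<close>.  Then all new exponents stay below the limit
  \<open>\<xi>\<close>, and \<open>\<omega>\<^bsup>\<xi>\<^esup>\<close> itself dominates them instead of \<open>\<omega>\<^bsup>\<xi>+1\<^esup>\<close>.

  Conversely, a multiset below the one of \<open>sum_S \<alpha>\<close> arises, up to enlarging it, by replacing a single
  exponent \<open>x\<close> by smaller ones.  If \<open>x\<close> belongs to a special element, a move lowers this element
  alone.  If \<open>x = q + 1\<close> comes from \<open>shift\<close>, a bounded number of copies of \<open>\<omega>\<^bsup>q\<^esup>\<close> has to be
  produced: by adding to \<open>F\<close> sufficiently many elements that exceed the new threshold by at least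
  \<open>\<omega>\<^bsup>q\<^esup>\<close>, or, if only finitely many such elements exist, by choosing a threshold that contains
  \<open>\<omega>\<^bsup>h\<^esup>\<close> sufficiently often, where \<open>q = h + 1\<close>.  Finally, if \<open>x\<close> is the limit exponent \<open>\<xi>\<close> of the
  exceptional case, the threshold may end with the smaller exponents themselves in place of \<open>\<xi>\<close>.
\<close>

section \<open>Size of the type of ordinals\<close>

unbundle cardinal_syntax

lemma ordIso_self_iff: "r =o r \<longleftrightarrow> Well_order r"
  using ordIso_reflexive[of r] by (auto simp: ordIso_def)

lemma abs_ordinal_less_iff:
  assumes "Well_order r" "Well_order s"
  shows "abs_ordinal r < abs_ordinal s \<longleftrightarrow> r <o s"
  using assms less_ordinal.abs_eq[of r s] by (simp add: ordIso_self_iff)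

lemma abs_ordinal_eqI: "r =o s \<Longrightarrow> abs_ordinal r = abs_ordinal s"
  by (rule Quotient_rel_abs[OF Quotient_ordinal])

text \<open>
  The ordinals below the order type of \<open>r\<close> are the order types of the proper initial segments of
  \<open>r\<close>, of which there are at most as many as elements of the field of \<open>r\<close>.
\<close>

lemma small_lessThan_ordinal:
  fixes a :: "'a ordinal"
  shows "|{..<a}| \<le>o |UNIV :: ('a + nat) set|"
proof (induction a rule: ordinal.abs_induct)
  case (1 r)
  then have r: "Well_order r" by (simp add: ordIso_self_iff)
  have "{..<abs_ordinal r} \<subseteq> (\<lambda>a. abs_ordinal (Restr r (underS r a))) ` Field r"
  proof
    fix x assume "x \<in> {..<abs_ordinal r}"
    then show "x \<in> (\<lambda>a. abs_ordinal (Restr r (underS r a))) ` Field r"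
    proof (induction x rule: ordinal.abs_induct)
      case (1 s)
      then have "Well_order s" by (simp add: ordIso_self_iff)
      with 1 r have "s <o r" by (simp add: abs_ordinal_less_iff)
      then obtain a where "a \<in> Field r" "s =o Restr r (underS r a)"
        using ordLess_iff_ordIso_Restr[OF r \<open>Well_order s\<close>] by blast
      then show ?case using abs_ordinal_eqI by blast
    qed
  qed
  then have "{..<abs_ordinal r} \<subseteq> (\<lambda>a. abs_ordinal (Restr r (underS r a))) ` UNIV" by blast
  then show ?case
    by (meson card_of_image card_of_mono1 ordLeq_transitive)
qed

text \<open>
  The Burali-Forti argument.  An injection of all ordinals into \<open>'a + nat\<close> would transport their order
  to a relation \<open>r\<close> which itself represents an ordinal.  Sending \<open>x\<close> to the type of the initial
  segment of \<open>r\<close> below the image of \<open>x\<close> is strictly increasing, hence \<open>\<ge> x\<close>, but all its values are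
  below the order type of \<open>r\<close>.
\<close>

lemma not_small_UNIV_ordinal: "\<not> |UNIV :: 'a ordinal set| \<le>o |UNIV :: ('a + nat) set|"
proof
  assume "|UNIV :: 'a ordinal set| \<le>o |UNIV :: ('a + nat) set|"
  then obtain g :: "'a ordinal \<Rightarrow> 'a + nat" where g: "inj g"
    using card_of_ordLeq[of "UNIV :: 'a ordinal set" "UNIV :: ('a + nat) set"] by blast
  define r where "r = dir_image {(x :: 'a ordinal, y). x \<le> y} g"
  have Field_le: "Field {(x :: 'a ordinal, y). x \<le> y} = UNIV"
    by (auto simp: Field_def)
  have "{(x :: 'a ordinal, y). x \<le> y} - Id = {(x, y). x < y}" by auto
  moreover have "refl {(x :: 'a ordinal, y). x \<le> y}" by (simp add: refl_on_def)
  moreover have "trans {(x :: 'a ordinal, y). x \<le> y}" by (rule transI) simp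
  moreover have "antisym {(x :: 'a ordinal, y). x \<le> y}" by (rule antisymI) simp
  moreover have "total {(x :: 'a ordinal, y). x \<le> y}" by (simp add: total_on_def linear)
  ultimately have "Well_order {(x :: 'a ordinal, y). x \<le> y}"
    using wf[where 'a = "'a ordinal"]
    by (simp add: well_order_on_def Field_le linear_order_on_def partial_order_on_def
        preorder_on_def)
  then have r: "Well_order r"
    unfolding r_def using g by (intro Well_order_dir_image) (auto simp: Field_le)
  define k where "k x = abs_ordinal (Restr r (underS r (g x)))" for x
  have filt: "wo_rel.ofilter r (underS r z)" for z
    using r by (simp add: wo_rel_def wo_rel.underS_ofilter)
  have "k x < k y" if "x < y" for x y
  proof -
    have "underS r (g x) = g ` {..<x}" for x
      unfolding r_def underS_def dir_image_def by (auto simp: inj_eq[OF g] less_le)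
    then have "underS r (g x) \<subset> underS r (g y)"
      using that by (auto simp add: psubset_eq inj_image_subset_iff[OF g] inj_image_eq_iff[OF g])
    then have "Restr r (underS r (g x)) <o Restr r (underS r (g y))"
      using ofilter_subset_ordLess[OF r filt filt] by simp
    then show ?thesis
      unfolding k_def using r by (simp add: abs_ordinal_less_iff Well_order_Restr)
  qed
  then have "x \<le> k x" for x
  proof (induction x rule: less_induct)
    case (less x)
    then show ?case by (metis leD leI)
  qed
  moreover have "k x < abs_ordinal r" for x
  proof -
    have "Field r \<noteq> {}" unfolding r_def by (simp add: dir_image_Field Field_le)
    then show ?thesis
      unfolding k_def using r by (simp add: abs_ordinal_less_iff Well_order_Restr underS_Restr_ordLess)
  qed
  ultimately show False by (metis leD)
qed

text \<open>
  By the two preceding lemmas, a union of few initial segments cannot exhaust the type.  All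
  suprema used below exist for this reason.
\<close>

lemma small_imp_strictly_bounded:
  fixes A :: "'a ordinal set"
  assumes "|A| \<le>o |UNIV :: ('a + nat) set|"
  shows "\<exists>c. \<forall>x\<in>A. x < c"
proof -
  have inf: "infinite (UNIV :: ('a + nat) set)" by simp
  have "|{..<x} \<union> {x}| \<le>o |UNIV :: ('a + nat) set|" for x :: "'a ordinal"
    using inf small_lessThan_ordinal
    by (intro card_of_Un_ordLeq_infinite_Field card_of_Card_order)
      (simp_all add: card_of_singl_ordLeq Field_card_of)
  then have "|\<Union>x\<in>A. {..<x} \<union> {x}| \<le>o |UNIV :: ('a + nat) set|"
    by (intro card_of_UNION_ordLeq_infinite[OF inf assms] ballI)
  then have "(\<Union>x\<in>A. {..<x} \<union> {x}) \<noteq> UNIV"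
    using not_small_UNIV_ordinal[where 'a = 'a] by (intro notI) simp
  then obtain c where "\<And>x. x \<in> A \<Longrightarrow> c \<notin> {..<x} \<union> {x}" by blast
  then have "\<forall>x\<in>A. x < c" by (auto simp: not_less le_less)
  then show ?thesis by blast
qed

lemma image_lessThan_strictly_bounded: "\<exists>c. \<forall>y<b. f y < c"
  for f :: "'a ordinal \<Rightarrow> 'a ordinal"
proof -
  have "|f ` {..<b}| \<le>o |UNIV :: ('a + nat) set|"
    using card_of_image small_lessThan_ordinal by (rule ordLeq_transitive)
  then show ?thesis using small_imp_strictly_bounded by blast
qed

lemma sequence_strictly_bounded: "\<exists>c. \<forall>n. f n < c"
  for f :: "nat \<Rightarrow> 'a ordinal"
proof -
  have "range f \<subseteq> (\<lambda>z. f (case z of Inl _ \<Rightarrow> 0 | Inr n \<Rightarrow> n)) ` (UNIV :: ('a + nat) set)"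
    by (force split: sum.split)
  then have "|range f| \<le>o |UNIV :: ('a + nat) set|"
    by (meson card_of_image card_of_mono1 ordLeq_transitive)
  then show ?thesis using small_imp_strictly_bounded by blast
qed

unbundle no cardinal_syntax

section \<open>Ordinal addition\<close>

text \<open>
  All arithmetical operations are least elements of upward closed sets.  In this form they are
  characterised by their upper bounds, which makes equations provable by comparing upper bounds.
\<close>

lemma Least_le_iff:
  fixes P :: "'b :: wellorder \<Rightarrow> bool"
  assumes "\<exists>c. P c" and "\<And>c d. P c \<Longrightarrow> c \<le> d \<Longrightarrow> P d"
  shows "(LEAST c. P c) \<le> z \<longleftrightarrow> P z"
  using LeastI_ex[OF assms(1)] assms(2) Least_le by blast

lemma ordinal_not_less_zero [simp]: "\<not> (x :: 'a ordinal) < 0"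
  unfolding zero_ordinal_def
proof (induction x rule: ordinal.abs_induct)
  case (1 r)
  then have "Well_order r" by (simp add: ordIso_self_iff)
  then show ?case
    using ordLess_iff_ordIso_Restr[of "{}" r] by (simp add: abs_ordinal_less_iff)
qed

lemma ordinal_zero_le [simp]: "0 \<le> (x :: 'a ordinal)"
  by (rule leI) simp

lemma ordinal_le_zero_iff [simp]: "(x :: 'a ordinal) \<le> 0 \<longleftrightarrow> x = 0"
  by (auto intro: antisym)

lemma ordinal_zero_less_iff: "0 < (x :: 'a ordinal) \<longleftrightarrow> x \<noteq> 0"
  by (auto simp: less_le)

lemma ordinal_one_le_iff: "1 \<le> (x :: 'a ordinal) \<longleftrightarrow> 0 < x"
proof -
  have "\<exists>c :: 'a ordinal. 0 < c"
    using sequence_strictly_bounded[of "\<lambda>_. 0"] by blast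
  then show ?thesis
    unfolding one_ordinal_def by (intro Least_le_iff) auto
qed

lemma ordinal_less_one_iff: "(x :: 'a ordinal) < 1 \<longleftrightarrow> x = 0"
  using ordinal_one_le_iff[of x] by (auto simp: not_le[symmetric])

lemma ordinal_plus_le_iff:
  "(a :: 'a ordinal) + b \<le> z \<longleftrightarrow> a \<le> z \<and> (\<forall>y<b. a + y < z)"
proof -
  obtain c where "\<forall>y<b. a + y < c"
    using image_lessThan_strictly_bounded[of b "\<lambda>y. a + y"] by blast
  then have "\<exists>c. a \<le> c \<and> (\<forall>y<b. a + y < c)"
    by (intro exI[of _ "max a c"]) (auto simp: less_max_iff_disj)
  then show ?thesis
    unfolding plus_ordinal.simps[of a b] Ball_def lessThan_iff
    by (intro Least_le_iff) (auto intro: order_trans less_le_trans)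
qed

lemma ordinal_le_plus_left: "(a :: 'a ordinal) \<le> a + b"
  using ordinal_plus_le_iff[of a b "a + b"] by simp

lemma ordinal_plus_strict_mono: "y < b \<Longrightarrow> (a :: 'a ordinal) + y < a + b"
  using ordinal_plus_le_iff[of a b "a + b"] by simp

lemma ordinal_plus_less_cancel [simp]: "(a :: 'a ordinal) + b < a + c \<longleftrightarrow> b < c"
  using ordinal_plus_strict_mono[of b c a] ordinal_plus_strict_mono[of c b a]
  by (cases b c rule: linorder_cases) (auto dest: less_asym)

lemma ordinal_plus_le_cancel [simp]: "(a :: 'a ordinal) + b \<le> a + c \<longleftrightarrow> b \<le> c"
  by (simp add: not_less[symmetric])

lemma ordinal_plus_eq_cancel [simp]: "(a :: 'a ordinal) + b = a + c \<longleftrightarrow> b = c"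
  by (simp add: eq_iff)

lemma ordinal_le_plus_right: "(b :: 'a ordinal) \<le> a + b"
proof (induction b rule: less_induct)
  case (less b)
  show ?case
  proof (rule ccontr)
    assume "\<not> b \<le> a + b"
    then have *: "a + b < b" by simp
    then have "a + (a + b) < a + b" by (rule ordinal_plus_strict_mono)
    with less.IH[OF *] show False by simp
  qed
qed

lemma ordinal_plus_diff_ex:
  assumes "(a :: 'a ordinal) \<le> c"
  obtains x where "a + x = c"
proof -
  have ex: "\<exists>x. c \<le> a + x" using ordinal_le_plus_right by blast
  define x where "x = (LEAST x. c \<le> a + x)"
  have "c \<le> a + x" unfolding x_def by (rule LeastI_ex[OF ex])
  moreover have "a + y < c" if "y < x" for y
    using not_less_Least[OF that[unfolded x_def]] by simp
  then have "a + x \<le> c" using assms by (simp add: ordinal_plus_le_iff)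
  ultimately show ?thesis using that antisym by blast
qed

lemma ordinal_less_plus_iff:
  "(z :: 'a ordinal) < a + b \<longleftrightarrow> z < a \<or> (\<exists>y<b. z = a + y)"
proof (cases "z < a")
  case True
  then show ?thesis using ordinal_le_plus_left by (auto intro: less_le_trans)
next
  case False
  then have "a \<le> z" by simp
  then obtain x where "a + x = z" by (rule ordinal_plus_diff_ex)
  then show ?thesis using False by auto
qed

lemma ordinal_add_assoc: "(a :: 'a ordinal) + b + c = a + (b + c)"
proof (induction c rule: less_induct)
  case (less c)
  have "a + b + c \<le> z \<longleftrightarrow> a + (b + c) \<le> z" for z
    unfolding ordinal_plus_le_iff[of "a + b" c] ordinal_plus_le_iff[of a "b + c"]
    using less by (auto simp: ordinal_less_plus_iff ordinal_plus_le_iff[of a b])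
  then show ?case by (simp add: eq_iff)
qed

lemma ordinal_add_0_left: "0 + a = (a :: 'a ordinal)"
proof (induction a rule: less_induct)
  case (less a)
  then have "0 + a \<le> a" by (simp add: ordinal_plus_le_iff[of 0 a])
  then show ?case using ordinal_le_plus_right by (rule antisym)
qed

lemma ordinal_add_0_right: "a + 0 = (a :: 'a ordinal)"
  using ordinal_plus_le_iff[of a 0 a] by (simp add: antisym ordinal_le_plus_left)

instance ordinal :: (type) monoid_add
  by standard (rule ordinal_add_assoc ordinal_add_0_left ordinal_add_0_right)+

lemma ordinal_plus_mono_left: "(a :: 'a ordinal) \<le> a' \<Longrightarrow> a + b \<le> a' + b"
proof (induction b rule: less_induct)
  case (less b)
  have "a + y < a' + b" if "y < b" for y
    using less.IH[OF that less.prems] ordinal_plus_strict_mono[OF that] by (rule le_less_trans)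
  moreover have "a \<le> a' + b"
    using less.prems ordinal_le_plus_left by (rule order_trans)
  ultimately show ?case by (simp add: ordinal_plus_le_iff[of a b])
qed

lemma ordinal_less_succ_iff: "(x :: 'a ordinal) < a + 1 \<longleftrightarrow> x \<le> a"
  by (auto simp: ordinal_less_plus_iff ordinal_less_one_iff)

lemma ordinal_succ_le_iff: "(a :: 'a ordinal) + 1 \<le> x \<longleftrightarrow> a < x"
  by (simp add: ordinal_less_succ_iff flip: not_less)

lemma left_diff_unique: "left_diff c ((c :: 'a ordinal) + x) = x"
  unfolding left_diff_def by simp

lemma plus_left_diff: "c \<le> a \<Longrightarrow> (c :: 'a ordinal) + left_diff c a = a"
  by (erule ordinal_plus_diff_ex) (auto simp: left_diff_unique)

lemma left_diff_le_iff: "c \<le> a \<Longrightarrow> left_diff c a \<le> x \<longleftrightarrow> (a :: 'a ordinal) \<le> c + x"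
  using ordinal_plus_le_cancel[of c "left_diff c a" x] by (simp add: plus_left_diff)

lemma left_diff_less_iff: "c \<le> a \<Longrightarrow> left_diff c a < x \<longleftrightarrow> (a :: 'a ordinal) < c + x"
  using ordinal_plus_less_cancel[of c "left_diff c a" x] by (simp add: plus_left_diff)

lemma left_diff_antimono_left:
  assumes "c \<le> d" "d \<le> (a :: 'a ordinal)"
  shows "left_diff d a \<le> left_diff c a"
proof -
  have "a = c + left_diff c a" using assms by (simp add: plus_left_diff)
  also have "\<dots> \<le> d + left_diff c a" using assms(1) by (rule ordinal_plus_mono_left)
  finally show ?thesis using assms(2) by (simp add: left_diff_le_iff)
qed

section \<open>Multiplication by \<open>\<omega>\<close>\<close>

text \<open>
  The product with \<open>\<omega>\<close> is the supremum of these finite multiples.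
\<close>

fun ordinal_nmult :: "nat \<Rightarrow> 'a ordinal \<Rightarrow> 'a ordinal" where
  "ordinal_nmult 0 a = 0"
| "ordinal_nmult (Suc n) a = ordinal_nmult n a + a"

lemma ordinal_nmult_Suc_left: "ordinal_nmult (Suc n) a = a + ordinal_nmult n a"
  by (induction n) (simp_all add: add.assoc)

lemma ex_limit_ordinal: "\<exists>a :: 'a ordinal. is_limit a"
proof -
  obtain u :: "'a ordinal" where u: "\<And>n. ordinal_nmult n 1 < u"
    using sequence_strictly_bounded[of "\<lambda>n. ordinal_nmult n 1"] by blast
  define s :: "'a ordinal" where "s = (LEAST s. \<forall>n. ordinal_nmult n 1 < s)"
  have s: "\<And>n. ordinal_nmult n 1 < s"
    unfolding s_def using LeastI[of "\<lambda>s. \<forall>n. ordinal_nmult n 1 < s" u] u by blast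
  have "s \<noteq> b + 1" for b
  proof
    assume *: "s = b + 1"
    have "ordinal_nmult n 1 < b" for n
      using s[of "Suc n"] * ordinal_less_succ_iff[of "ordinal_nmult n 1" "ordinal_nmult n 1"]
      by (auto simp: ordinal_less_succ_iff[of _ b] intro: less_le_trans)
    then have "s \<le> b" unfolding s_def by (intro Least_le) simp
    then show False using * ordinal_less_succ_iff[of b b] by simp
  qed
  moreover have "s \<noteq> 0" using s[of 0] by auto
  ultimately show ?thesis unfolding is_limit_def by blast
qed

lemma is_limit_omega: "is_limit (\<omega> :: 'a ordinal)"
  unfolding omega_def by (rule LeastI_ex[OF ex_limit_ordinal])

lemma is_limit_succ_less: "is_limit l \<Longrightarrow> x < l \<Longrightarrow> (x :: 'a ordinal) + 1 < l"
  using linorder_less_linear[of "x + 1" l] by (auto simp: is_limit_def ordinal_less_succ_iff)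

lemma less_omega_iff: "(x :: 'a ordinal) < \<omega> \<longleftrightarrow> (\<exists>n. x = ordinal_nmult n 1)"
proof
  show "\<exists>n. x = ordinal_nmult n 1" if "x < \<omega>"
    using that
  proof (induction x rule: less_induct)
    case (less x)
    have "\<not> is_limit x" using less.prems unfolding omega_def by (rule not_less_Least)
    then consider "x = 0" | y where "x = y + 1" unfolding is_limit_def by blast
    then show ?case
    proof cases
      case 1
      then show ?thesis by (metis ordinal_nmult.simps(1))
    next
      case 2
      then have "y < x" by (simp add: ordinal_less_succ_iff)
      then obtain n where "y = ordinal_nmult n 1"
        using less.IH[of y] less.prems by fastforce
      then have "x = ordinal_nmult (Suc n) 1" using 2 by simp
      then show ?thesis by blast
    qed
  qed
next
  have "ordinal_nmult n 1 < (\<omega> :: 'a ordinal)" for n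
    using is_limit_omega
    by (induction n) (auto simp: is_limit_succ_less ordinal_zero_less_iff is_limit_def)
  then show "\<exists>n. x = ordinal_nmult n 1 \<Longrightarrow> x < \<omega>" by blast
qed

lemma ordinal_times_le_iff: "(a :: 'a ordinal) * b \<le> z \<longleftrightarrow> (\<forall>y<b. a * y + a \<le> z)"
proof -
  have "\<exists>c. \<forall>y<b. a * y + a \<le> c"
    using image_lessThan_strictly_bounded[of b "\<lambda>y. a * y + a"] by (blast intro: less_imp_le)
  then show ?thesis
    unfolding times_ordinal.simps[of a b] Ball_def lessThan_iff
    by (intro Least_le_iff) (auto intro: order_trans)
qed

lemma ordinal_times_nmult_one: "(a :: 'a ordinal) * ordinal_nmult n 1 = ordinal_nmult n a"
proof (induction n)
  case 0
  then show ?case using ordinal_times_le_iff[of a 0 0] by simp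
next
  case (Suc n)
  have mono: "a * y \<le> a * x" if "y \<le> x" for x y
    using that ordinal_times_le_iff[of a x "a * x"] by (simp add: ordinal_times_le_iff[of a y])
  have "a * (x + 1) \<le> z \<longleftrightarrow> a * x + a \<le> z" for x z
    unfolding ordinal_times_le_iff[of a "x + 1"] ordinal_less_succ_iff
    by (auto intro: order_trans[OF ordinal_plus_mono_left[OF mono]])
  then have "a * (x + 1) = a * x + a" for x by (simp add: eq_iff)
  then show ?case using Suc by simp
qed

lemma ordinal_times_omega_le_iff: "(a :: 'a ordinal) * \<omega> \<le> z \<longleftrightarrow> (\<forall>n. ordinal_nmult n a \<le> z)"
proof -
  have "a * \<omega> \<le> z \<longleftrightarrow> (\<forall>n. ordinal_nmult (Suc n) a \<le> z)"
    unfolding ordinal_times_le_iff[of a \<omega>] less_omega_iff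
    by (auto simp: ordinal_times_nmult_one)
  also have "\<dots> \<longleftrightarrow> (\<forall>n. ordinal_nmult n a \<le> z)"
  proof (intro iffI allI)
    fix n assume "\<forall>n. ordinal_nmult (Suc n) a \<le> z"
    then show "ordinal_nmult n a \<le> z" by (cases n) simp_all
  qed blast
  finally show ?thesis .
qed

text \<open>
  One more summand in front of infinitely many does not change the supremum; this is the source of
  all absorption laws below.
\<close>

lemma plus_times_omega: "(a :: 'a ordinal) + a * \<omega> = a * \<omega>"
proof (rule antisym)
  have "a + y < a * \<omega>" if "y < a * \<omega>" for y
  proof -
    have "\<not> a * \<omega> \<le> y" using that by simp
    then obtain n where "y < ordinal_nmult n a"
      by (auto simp: ordinal_times_omega_le_iff not_le)
    then have "a + y < ordinal_nmult (Suc n) a"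
      unfolding ordinal_nmult_Suc_left by simp
    also have "\<dots> \<le> a * \<omega>" using ordinal_times_omega_le_iff[of a "a * \<omega>"] by blast
    finally show ?thesis .
  qed
  moreover have "a \<le> a * \<omega>"
    using ordinal_times_omega_le_iff[of a "a * \<omega>"] by (auto dest: spec[of _ 1])
  ultimately show "a + a * \<omega> \<le> a * \<omega>" by (simp add: ordinal_plus_le_iff)
qed (rule ordinal_le_plus_right)

section \<open>Powers of \<open>\<omega>\<close>\<close>

lemma omega_pow_le_iff:
  "omega_pow (b :: 'a ordinal) \<le> z \<longleftrightarrow> 1 \<le> z \<and> (\<forall>y<b. omega_pow y * \<omega> \<le> z)"
proof -
  obtain c where "\<forall>y<b. omega_pow y * \<omega> < c"
    using image_lessThan_strictly_bounded[of b "\<lambda>y. omega_pow y * \<omega>"] by blast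
  then have "\<exists>c. 1 \<le> c \<and> (\<forall>y<b. omega_pow y * \<omega> \<le> c)"
    by (intro exI[of _ "max 1 c"]) (auto intro: less_imp_le max.coboundedI2)
  then show ?thesis
    unfolding omega_pow.simps[of b] Ball_def lessThan_iff
    by (intro Least_le_iff) (auto intro: order_trans)
qed

lemma omega_pow_pos [simp]: "0 < omega_pow (b :: 'a ordinal)"
  using omega_pow_le_iff[of b "omega_pow b"] by (simp add: ordinal_one_le_iff)

lemma omega_pow_times_omega_le: "y < b \<Longrightarrow> omega_pow y * \<omega> \<le> omega_pow (b :: 'a ordinal)"
  using omega_pow_le_iff[of b "omega_pow b"] by simp

lemma omega_pow_absorb: "y < b \<Longrightarrow> omega_pow y + omega_pow b = omega_pow (b :: 'a ordinal)"
proof -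
  assume "y < b"
  from omega_pow_times_omega_le[OF this] obtain u where "omega_pow y * \<omega> + u = omega_pow b"
    by (rule ordinal_plus_diff_ex)
  then show ?thesis by (metis add.assoc plus_times_omega)
qed

lemma omega_pow_strict_mono: "y < b \<Longrightarrow> omega_pow y < omega_pow (b :: 'a ordinal)"
  using ordinal_plus_strict_mono[OF omega_pow_pos[of b], of "omega_pow y"]
  by (simp add: omega_pow_absorb)

lemma less_omega_powE:
  assumes "x < omega_pow (b :: 'a ordinal)"
  obtains "x = 0" | y n where "y < b" "x < ordinal_nmult n (omega_pow y)"
proof -
  have "\<not> omega_pow b \<le> x" using assms by simp
  then consider "\<not> 1 \<le> x" | y where "y < b" "\<not> omega_pow y * \<omega> \<le> x"
    unfolding omega_pow_le_iff by blast
  then show ?thesis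
  proof cases
    case 1
    then show ?thesis using that by (simp add: ordinal_one_le_iff ordinal_zero_less_iff)
  next
    case 2
    then show ?thesis using that by (auto simp: ordinal_times_omega_le_iff not_le)
  qed
qed

text \<open>
  Powers of \<open>\<omega>\<close> are additively indecomposable: \<open>x\<close> is below a finite multiple of a smaller power,
  and every smaller power is absorbed.
\<close>

lemma less_omega_pow_absorb:
  assumes "x < omega_pow (b :: 'a ordinal)"
  shows "x + omega_pow b = omega_pow b"
  using assms
proof (cases rule: less_omega_powE)
  case (2 y n)
  have "ordinal_nmult n (omega_pow y) + omega_pow b = omega_pow b"
    using \<open>y < b\<close> by (induction n) (simp_all add: add.assoc omega_pow_absorb)
  then show ?thesis
    using ordinal_plus_mono_left[OF less_imp_le[OF 2(2)], of "omega_pow b"]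
    by (simp add: antisym ordinal_le_plus_right)
qed simp

lemma plus_less_omega_pow:
  "x < omega_pow b \<Longrightarrow> y < omega_pow b \<Longrightarrow> x + y < omega_pow (b :: 'a ordinal)"
  using less_omega_pow_absorb[of x b] ordinal_plus_strict_mono[of y "omega_pow b" x] by simp

section \<open>The order of multisets\<close>

text \<open>
  In a linear order, the smaller of two multisets leaves the larger one at a definite exponent: in
  decreasing order both start with \<open>P\<close>, then the larger one continues with \<open>q\<close> and the smaller one
  with exponents below \<open>q\<close>.
\<close>

lemma multiset_less_split:
  fixes M N :: "'b :: linorder multiset"
  assumes "M < N"
  obtains P q Q R where "N = P + add_mset q Q" "M = P + R"
    "\<forall>p\<in>#P. q \<le> p" "\<forall>x\<in>#Q. x \<le> q" "\<forall>r\<in>#R. r < q"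
proof -
  obtain X Y where X: "X \<noteq> {#}" "X \<subseteq># N" and M: "M = N - X + Y"
    and Y: "\<forall>k\<in>#Y. \<exists>a\<in>#X. k < a"
    using assms unfolding less_multiset\<^sub>D\<^sub>M by blast
  define q where "q = Max (set_mset X)"
  have q: "q \<in># X" and q_max: "\<And>x. x \<in># X \<Longrightarrow> x \<le> q"
    unfolding q_def using X(1) by (auto intro: Max_in)
  define K where "K = N - X"
  have N: "N = K + X" unfolding K_def using X(2) by simp
  have K: "K = filter_mset (\<lambda>x. q \<le> x) K + filter_mset (\<lambda>x. \<not> q \<le> x) K"
    by (rule multiset_partition)
  have X': "X = add_mset q (X - {#q#})" using q by simp
  show thesis
  proof (rule that)
    show "N = filter_mset (\<lambda>x. q \<le> x) K + add_mset q (filter_mset (\<lambda>x. \<not> q \<le> x) K + (X - {#q#}))"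
      using N K X' by (metis add.assoc union_mset_add_mset_right)
    show "M = filter_mset (\<lambda>x. q \<le> x) K + (filter_mset (\<lambda>x. \<not> q \<le> x) K + Y)"
      using M K unfolding K_def[symmetric] by (metis add.assoc)
    show "\<forall>x\<in>#filter_mset (\<lambda>x. \<not> q \<le> x) K + (X - {#q#}). x \<le> q"
      using q_max by (auto dest: in_diffD)
    show "\<forall>r\<in>#filter_mset (\<lambda>x. \<not> q \<le> x) K + Y. r < q"
      using Y q_max by (auto simp: not_le intro: less_le_trans)
  qed simp
qed

text \<open>
  The multisets \<open>N - {#x#} + Y\<close> with all elements of \<open>Y\<close> below \<open>x\<close> are cofinal below \<open>N\<close>, so only
  these have to be considered for lower bounds.
\<close>

lemma multiset_less_replace_one:
  fixes M N :: "'b :: linorder multiset"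
  assumes "M < N"
  obtains x Y where "x \<in># N" "\<forall>y\<in>#Y. y < x" "M \<le> N - {#x#} + Y"
proof -
  obtain P q Q R where "N = P + add_mset q Q" "M = P + R" "\<forall>r\<in>#R. r < q"
    using assms by (rule multiset_less_split)
  then show thesis
    by (intro that[of q R]) (auto simp: ac_simps)
qed

section \<open>Normal forms as multisets of exponents\<close>

lemma of_cnf_empty [simp]: "of_cnf {#} = 0"
  by (simp add: of_cnf_def)

lemma of_cnf_add_max:
  assumes "\<forall>y\<in>#M. y \<le> x"
  shows "of_cnf (add_mset x M) = omega_pow x + of_cnf M"
proof -
  let ?xs = "sorted_list_of_multiset M"
  have "sorted (?xs @ [x])" using assms by (simp add: sorted_append)
  moreover have "add_mset x M = mset (?xs @ [x])" by simp
  ultimately have "sorted_list_of_multiset (add_mset x M) = ?xs @ [x]"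
    by (metis sorted_list_of_multiset_mset sorted_sort_id)
  then show ?thesis by (simp add: of_cnf_def)
qed

lemma of_cnf_single [simp]: "of_cnf {#x#} = omega_pow x"
  using of_cnf_add_max[of "{#}" x] by simp

lemma of_cnf_less_omega_pow:
  "\<forall>m\<in>#M. m < x \<Longrightarrow> of_cnf M < omega_pow x"
proof (induction M rule: multiset_induct_max)
  case (add y M)
  then show ?case
    by (simp add: of_cnf_add_max plus_less_omega_pow omega_pow_strict_mono)
qed simp

text \<open>
  The maxima decide, since the rest of a multiset with maximum \<open>< y\<close> cannot add up to \<open>\<omega>\<^bsup>y\<^esup>\<close>; equal
  maxima are cancelled on both sides.
\<close>

lemma of_cnf_strict_mono: "M < N \<Longrightarrow> of_cnf M < of_cnf N"
proof (induction M arbitrary: N rule: multiset_induct_max)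
  case empty
  then have "N \<noteq> {#}" by auto
  then show ?case
  proof (induction N rule: multiset_induct_max)
    case (add y N)
    then show ?case
      using less_le_trans[OF omega_pow_pos ordinal_le_plus_left] by (simp add: of_cnf_add_max)
  qed simp
next
  case (add x M)
  from add.prems have "N \<noteq> {#}" by auto
  then obtain y N' where N: "N = add_mset y N'" "\<forall>z\<in>#N'. z \<le> y"
    by (induction N rule: multiset_induct_max) auto
  consider "x < y" | "x = y" | "y < x" by (rule linorder_cases)
  then show ?case
  proof cases
    case 1
    then have "of_cnf (add_mset x M) < omega_pow y"
      using add.hyps by (intro of_cnf_less_omega_pow) (auto intro: le_less_trans)
    then show ?thesis
      using N less_le_trans[OF _ ordinal_le_plus_left] by (simp add: of_cnf_add_max)
  next
    case 2
    then have "M < N'" using add.prems N(1) by simp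
    then show ?thesis using add.IH N 2 add.hyps by (simp add: of_cnf_add_max)
  next
    case 3
    then have "N < {#x#}" using N by (auto intro: le_less_trans)
    also have "{#x#} \<le> add_mset x M" by simp
    finally show ?thesis using add.prems by simp
  qed
qed

lemma of_cnf_less_iff [simp]: "of_cnf M < of_cnf N \<longleftrightarrow> M < N"
  using of_cnf_strict_mono[of M N] of_cnf_strict_mono[of N M]
  by (cases M N rule: linorder_cases) (auto dest: less_asym)

lemma of_cnf_le_iff [simp]: "of_cnf M \<le> of_cnf N \<longleftrightarrow> M \<le> N"
  by (simp add: not_less[symmetric])

lemma of_cnf_eq_iff [simp]: "of_cnf M = of_cnf N \<longleftrightarrow> M = N"
  by (simp add: eq_iff)

lemma le_omega_pow: "a \<le> omega_pow (a :: 'a ordinal)"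
proof (induction a rule: less_induct)
  case (less a)
  show ?case
  proof (rule ccontr)
    assume "\<not> a \<le> omega_pow a"
    then have *: "omega_pow a < a" by simp
    then have "omega_pow (omega_pow a) < omega_pow a" by (rule omega_pow_strict_mono)
    with less[OF *] show False by simp
  qed
qed

text \<open>
  Split off the largest power \<open>\<omega>\<^bsup>x\<^esup> \<le> a\<close>.  The remainder is smaller than \<open>a\<close>, for otherwise
  \<open>\<omega>\<^bsup>x\<^esup>\<close> could be split off infinitely often, contrary to the choice of \<open>x\<close>.
\<close>

lemma of_cnf_surj: "\<exists>M. of_cnf M = a"
proof (induction a rule: less_induct)
  case (less a)
  show ?case
  proof (cases "a = 0")
    case False
    define h where "h = (LEAST h. a < omega_pow h)"
    have "a < omega_pow (a + 1)"
      using le_omega_pow[of a] omega_pow_strict_mono[of a "a + 1"]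
      by (simp add: ordinal_less_succ_iff)
    then have h: "a < omega_pow h" unfolding h_def by (rule LeastI)
    then obtain x n where x: "x < h" "a < ordinal_nmult n (omega_pow x)"
      using False by (cases rule: less_omega_powE) auto
    then have "omega_pow x \<le> a"
      using not_less_Least[of x "\<lambda>h. a < omega_pow h"] unfolding h_def by simp
    then obtain a' where a': "omega_pow x + a' = a" by (rule ordinal_plus_diff_ex)
    have "a' \<noteq> a"
    proof
      assume "a' = a"
      then have "ordinal_nmult n (omega_pow x) + a = a" for n
        using a' by (induction n) (simp_all add: add.assoc)
      then show False using ordinal_le_plus_left[of "ordinal_nmult n (omega_pow x)" a] x by simp
    qed
    then have "a' < a" using ordinal_le_plus_right[of a' "omega_pow x"] a' by simp
    then obtain M where M: "of_cnf M = a'" using less by blast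
    have "m \<le> x" if "m \<in># M" for m
    proof (rule ccontr)
      assume "\<not> m \<le> x"
      then have "omega_pow x * \<omega> \<le> omega_pow m" by (simp add: omega_pow_times_omega_le)
      then have "ordinal_nmult n (omega_pow x) \<le> of_cnf {#m#}"
        by (simp add: ordinal_times_omega_le_iff)
      also have "\<dots> \<le> of_cnf M"
        unfolding of_cnf_le_iff using that by (intro subset_eq_imp_le_multiset) simp
      finally show False using x(2) \<open>a' < a\<close> M by simp
    qed
    then have "of_cnf (add_mset x M) = a" using a' M by (simp add: of_cnf_add_max)
    then show ?thesis by blast
  qed (use of_cnf_empty in blast)
qed

lemma cnf_of_cnf [simp]: "cnf (of_cnf M) = M"
  unfolding cnf_def by simp

lemma of_cnf_cnf [simp]: "of_cnf (cnf a) = a"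
  using of_cnf_surj[of a] by auto

lemma cnf_less_iff: "cnf a < cnf b \<longleftrightarrow> a < b"
  using of_cnf_less_iff[of "cnf a" "cnf b"] by simp

lemma cnf_le_iff: "cnf a \<le> cnf b \<longleftrightarrow> a \<le> b"
  using of_cnf_le_iff[of "cnf a" "cnf b"] by simp

lemma cnf_0 [simp]: "cnf 0 = {#}"
  using cnf_of_cnf[of "{#}"] by simp

lemma cnf_omega_pow [simp]: "cnf (omega_pow x) = {#x#}"
  using cnf_of_cnf[of "{#x#}"] by simp

lemma cnf_eq_empty_iff [simp]: "cnf a = {#} \<longleftrightarrow> a = 0"
  by (metis cnf_0 of_cnf_cnf)

text \<open>
  In an ordinal sum, the exponents of the left summand that are smaller than some exponent of the
  right summand are absorbed.
\<close>

lemma of_cnf_plus: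
  "of_cnf M + of_cnf N = of_cnf (filter_mset (\<lambda>x. \<forall>y\<in>#N. y \<le> x) M + N)"
proof (induction M rule: multiset_induct_max)
  case (add x M)
  have "of_cnf (add_mset x M) + of_cnf N =
      omega_pow x + of_cnf (filter_mset (\<lambda>x. \<forall>y\<in>#N. y \<le> x) M + N)"
    using add by (simp add: of_cnf_add_max add.assoc)
  also have "\<dots> = of_cnf (filter_mset (\<lambda>x. \<forall>y\<in>#N. y \<le> x) (add_mset x M) + N)"
  proof (cases "\<forall>y\<in>#N. y \<le> x")
    case True
    then show ?thesis using add.hyps by (subst of_cnf_add_max[symmetric]) auto
  next
    case False
    then have none: "filter_mset (\<lambda>x. \<forall>y\<in>#N. y \<le> x) M = {#}"
      using add.hyps by (auto intro: order_trans)
    from False obtain y N' where N: "N = add_mset y N'" "\<forall>z\<in>#N'. z \<le> y"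
      by (induction N rule: multiset_induct_max) auto
    moreover have "x < y" using False N by (auto intro: less_le_trans)
    ultimately have "omega_pow x + of_cnf N = of_cnf N"
      by (simp add: of_cnf_add_max add.assoc[symmetric] omega_pow_absorb)
    moreover have "filter_mset (\<lambda>x. \<forall>y\<in>#N. y \<le> x) (add_mset x M) = {#}"
      using False none by simp
    ultimately show ?thesis unfolding none by simp
  qed
  finally show ?case .
qed simp

lemma of_cnf_plus_prefix:
  assumes "\<forall>p\<in>#P. \<forall>q\<in>#Q. q \<le> p"
  shows "of_cnf P + of_cnf Q = of_cnf (P + Q)"
  using assms by (simp add: of_cnf_plus filter_mset_eq_conv)

lemma cnf_nat_add [simp]: "cnf (a \<oplus> b) = cnf a + cnf b"
  by (simp add: nat_add_def)

lemma cnf_nat_sum [simp]: "cnf (nat_sum f I) = (\<Sum>i\<in>I. cnf (f i))"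
  by (simp add: nat_sum_def)

lemma cnf_plus_le: "cnf (a + b) \<le> cnf a + cnf b"
proof -
  have "cnf (a + b) = filter_mset (\<lambda>x. \<forall>y\<in>#cnf b. y \<le> x) (cnf a) + cnf b"
    using of_cnf_plus[of "cnf a" "cnf b"] by simp
  then show ?thesis by (simp add: subset_eq_imp_le_multiset)
qed

lemma omega_pow_zero: "omega_pow 0 = (1 :: 'a ordinal)"
  by (rule antisym) (auto simp: omega_pow_le_iff ordinal_one_le_iff)

lemma cnf_one [simp]: "cnf 1 = {#0#}"
  using cnf_omega_pow[of 0] by (simp add: omega_pow_zero)

lemma nat_add_one: "x \<oplus> 1 = (x :: 'a ordinal) + 1"
  using of_cnf_plus[of "cnf x" "{#0#}"] by (simp add: nat_add_def omega_pow_zero)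

lemma omega_pow_one: "omega_pow 1 = (\<omega> :: 'a ordinal)"
proof -
  have "omega_pow 1 \<le> z \<longleftrightarrow> \<omega> \<le> z" for z :: "'a ordinal"
  proof -
    have "omega_pow 1 \<le> z \<longleftrightarrow> 1 \<le> z \<and> (\<forall>n. ordinal_nmult n 1 \<le> z)"
      by (simp add: omega_pow_le_iff[of 1] ordinal_less_one_iff omega_pow_zero ordinal_times_omega_le_iff)
    also have "\<dots> \<longleftrightarrow> (\<forall>n. ordinal_nmult n 1 \<le> z)"
      by (auto dest: spec[of _ 1])
    also have "\<dots> \<longleftrightarrow> (\<forall>n. ordinal_nmult n 1 < z)"
    proof (intro iffI allI)
      fix n assume "\<forall>n. ordinal_nmult n 1 \<le> z"
      then have "ordinal_nmult (Suc n) 1 \<le> z" by blast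
      moreover have "ordinal_nmult n 1 < ordinal_nmult (Suc n) (1 :: 'a ordinal)"
        by (simp add: ordinal_less_succ_iff)
      ultimately show "ordinal_nmult n 1 < z" by simp
    qed (simp add: less_imp_le)
    also have "\<dots> \<longleftrightarrow> (\<forall>x<\<omega>. x < z)" by (auto simp: less_omega_iff)
    also have "\<dots> \<longleftrightarrow> \<omega> \<le> z" by (meson leD leI less_le_trans order_refl)
    finally show ?thesis .
  qed
  then show ?thesis by (simp add: eq_iff)
qed

lemma cnf_omega [simp]: "cnf \<omega> = {#1#}"
  using cnf_omega_pow[of 1] by (simp add: omega_pow_one)

lemma cnf_times_omega [simp]: "cnf (a \<otimes> \<omega>) = image_mset (\<lambda>x. x + 1) (cnf a)"
  by (simp add: nat_mult_def nat_add_one)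

lemma less_omega_pow_iff: "a < omega_pow x \<longleftrightarrow> (\<forall>y\<in>#cnf a. y < x)"
  using cnf_less_iff[of a "omega_pow x"] by simp

section \<open>Thresholds of a sequence and the special elements\<close>

abbreviation shift :: "'a ordinal multiset \<Rightarrow> 'a ordinal multiset" where
  "shift \<equiv> image_mset (\<lambda>x. x + 1)"

lemma le_shift: "M \<le> shift M"
proof (induction M)
  case (add x M)
  then show ?case
    by (simp add: add_mset_le_le_le less_imp_le ordinal_less_succ_iff)
qed simp

lemma le_replicate_mset: "\<forall>y\<in>#M. y \<le> q \<Longrightarrow> M \<le> replicate_mset (size M) (q :: 'a ordinal)"
  by (induction M) (auto intro: add_mset_le_le_le)

lemma seq_zeta_le_iff: "seq_zeta \<alpha> \<le> z \<longleftrightarrow> finite {i. z < \<alpha> i}"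
proof -
  obtain c where "\<forall>n. \<alpha> n < c" using sequence_strictly_bounded by blast
  then have "{i. c < \<alpha> i} = {}" by (auto dest: less_asym)
  then have "\<exists>c. finite {i. c < \<alpha> i}" by (metis finite.emptyI)
  then show ?thesis
    unfolding seq_zeta_def by (rule Least_le_iff) (auto elim!: rev_finite_subset)
qed

lemma seq_eps_le_iff: "seq_eps \<alpha> \<le> z \<longleftrightarrow> finite {i. z \<le> \<alpha> i}"
proof -
  obtain c where "\<forall>n. \<alpha> n < c" using sequence_strictly_bounded by blast
  then have "{i. c \<le> \<alpha> i} = {}" by (auto simp: not_le)
  then have "\<exists>c. finite {i. c \<le> \<alpha> i}" by (metis finite.emptyI)
  then show ?thesis
    unfolding seq_eps_def by (rule Least_le_iff) (auto elim!: rev_finite_subset)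
qed

lemma finite_above_seq_zeta: "finite {i. seq_zeta \<alpha> < \<alpha> i}"
  using seq_zeta_le_iff[of \<alpha> "seq_zeta \<alpha>"] by simp

lemma infinite_above_below_seq_zeta: "z < seq_zeta \<alpha> \<Longrightarrow> infinite {i. z < \<alpha> i}"
  by (simp flip: seq_zeta_le_iff)

lemma seq_zeta_le_seq_eps: "seq_zeta \<alpha> \<le> seq_eps \<alpha>"
proof -
  have "finite {i. seq_eps \<alpha> \<le> \<alpha> i}" using seq_eps_le_iff[of \<alpha> "seq_eps \<alpha>"] by simp
  then show ?thesis unfolding seq_zeta_le_iff by (rule rev_finite_subset) auto
qed

text \<open>
  The second threshold \<open>seq_eps \<alpha>\<close> equals \<open>seq_zeta \<alpha>\<close> or \<open>seq_zeta \<alpha> + 1\<close>, according to whether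
  finitely or infinitely many elements reach \<open>seq_zeta \<alpha>\<close>.
\<close>

lemma e_special_eq:
  "e_special \<alpha> =
    (if finite {i. seq_zeta \<alpha> \<le> \<alpha> i} then {i. seq_zeta \<alpha> \<le> \<alpha> i} else {i. seq_zeta \<alpha> < \<alpha> i})"
proof (cases "finite {i. seq_zeta \<alpha> \<le> \<alpha> i}")
  case True
  then have "seq_eps \<alpha> = seq_zeta \<alpha>"
    by (intro antisym seq_zeta_le_seq_eps) (simp add: seq_eps_le_iff)
  then show ?thesis using True by (simp add: e_special_def)
next
  case False
  then have "\<not> seq_eps \<alpha> \<le> seq_zeta \<alpha>" by (simp add: seq_eps_le_iff)
  then have "seq_zeta \<alpha> + 1 \<le> seq_eps \<alpha>" by (simp add: ordinal_succ_le_iff)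
  moreover have "seq_eps \<alpha> \<le> seq_zeta \<alpha> + 1"
    by (simp add: seq_eps_le_iff ordinal_succ_le_iff finite_above_seq_zeta)
  ultimately have "seq_eps \<alpha> = seq_zeta \<alpha> + 1" by simp
  then show ?thesis
    using False by (simp add: e_special_def ordinal_succ_le_iff)
qed

lemma cnf_drop_last:
  assumes "z \<noteq> 0"
  shows "cnf z = add_mset (last_exponent z) (cnf (drop_last z))"
    and "\<forall>y\<in>#cnf z. last_exponent z \<le> y"
  using assms Min_in[of "set_mset (cnf z)"] by (simp_all add: drop_last_def last_exponent_def)

lemma drop_last_plus: "z \<noteq> 0 \<Longrightarrow> drop_last z + omega_pow (last_exponent z) = z"
  using of_cnf_plus_prefix[of "cnf (drop_last z)" "{#last_exponent z#}"] cnf_drop_last[of z]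
  by (simp) (metis of_cnf_cnf add_mset_add_single)

text \<open>
  The condition for the first case in the definition of \<open>sum_S\<close>.  With the following three notions, both cases
  of the definition take the common form of \<open>cnf_sum_S\<close>.
\<close>

definition limit_case :: "(nat \<Rightarrow> 'a ordinal) \<Rightarrow> bool" where
  "limit_case \<alpha> \<longleftrightarrow> 0 < seq_zeta \<alpha> \<and> is_limit (last_exponent (seq_zeta \<alpha>)) \<and>
     finite {i. seq_zeta \<alpha> \<le> \<alpha> i}"

definition special_base :: "(nat \<Rightarrow> 'a ordinal) \<Rightarrow> 'a ordinal" where
  "special_base \<alpha> = (if limit_case \<alpha> then drop_last (seq_zeta \<alpha>) else seq_zeta \<alpha>)"

definition main_exps :: "(nat \<Rightarrow> 'a ordinal) \<Rightarrow> 'a ordinal multiset" where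
  "main_exps \<alpha> = (if limit_case \<alpha>
     then add_mset (last_exponent (seq_zeta \<alpha>)) (shift (cnf (drop_last (seq_zeta \<alpha>))))
     else shift (cnf (seq_zeta \<alpha>)))"

text \<open>
  Outside \<open>limit_case\<close>, elements equal to the threshold are left out even if they are e-special:
  their contribution \<open>-\<zeta> + \<zeta>\<close> is \<open>0\<close>.
\<close>

definition special :: "(nat \<Rightarrow> 'a ordinal) \<Rightarrow> nat set" where
  "special \<alpha> = (if limit_case \<alpha> then {i. seq_zeta \<alpha> \<le> \<alpha> i} else {i. seq_zeta \<alpha> < \<alpha> i})"

lemma finite_special [simp]: "finite (special \<alpha>)"
  using finite_above_seq_zeta[of \<alpha>] by (simp add: special_def limit_case_def)

lemma special_ge: "j \<in> special \<alpha> \<Longrightarrow> seq_zeta \<alpha> \<le> \<alpha> j"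
  by (auto simp: special_def split: if_splits)

lemma special_gt: "seq_zeta \<alpha> < \<alpha> j \<Longrightarrow> j \<in> special \<alpha>"
  by (auto simp: special_def)

lemma special_base_le: "special_base \<alpha> \<le> seq_zeta \<alpha>"
proof (cases "limit_case \<alpha>")
  case True
  then have "drop_last (seq_zeta \<alpha>) + omega_pow (last_exponent (seq_zeta \<alpha>)) = seq_zeta \<alpha>"
    by (intro drop_last_plus) (auto simp: limit_case_def)
  then show ?thesis
    using True ordinal_le_plus_left by (metis special_base_def)
qed (simp add: special_base_def)

lemma sum_left_diff_neutral:
  assumes "finite J" "{i. z < \<alpha> i} \<subseteq> J" "J \<subseteq> {i. z \<le> \<alpha> i}"
  shows "(\<Sum>i\<in>J. cnf (left_diff z (\<alpha> i))) = (\<Sum>i\<in>{i. z < \<alpha> i}. cnf (left_diff z (\<alpha> i)))"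
proof (rule sum.mono_neutral_right[OF assms(1,2)])
  have "left_diff z z = 0" using left_diff_unique[of z 0] by simp
  then show "\<forall>i\<in>J - {i. z < \<alpha> i}. cnf (left_diff z (\<alpha> i)) = 0"
    using assms(3) by (auto simp: less_le)
qed

lemma cnf_sum_S:
  "cnf (sum_S \<alpha>) = main_exps \<alpha> + (\<Sum>i\<in>special \<alpha>. cnf (left_diff (special_base \<alpha>) (\<alpha> i)))"
proof (cases "limit_case \<alpha>")
  case True
  then have "e_special \<alpha> = special \<alpha>"
    by (simp add: e_special_eq special_def limit_case_def)
  with True show ?thesis
    by (simp add: sum_S_def Let_def limit_case_def[symmetric] special_base_def main_exps_def)
next
  case False
  have "(\<Sum>i\<in>e_special \<alpha>. cnf (left_diff (seq_zeta \<alpha>) (\<alpha> i))) =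
      (\<Sum>i\<in>special \<alpha>. cnf (left_diff (seq_zeta \<alpha>) (\<alpha> i)))"
    unfolding special_def if_not_P[OF False]
    by (rule sum_left_diff_neutral) (auto simp: e_special_eq finite_above_seq_zeta)
  with False show ?thesis
    by (simp add: sum_S_def Let_def limit_case_def[symmetric] special_base_def main_exps_def)
qed

section \<open>The sum after a move\<close>

text \<open>
  The outcome of a move with exception set \<open>F\<close> and ordinal \<open>b\<close>; such a move is legal if \<open>b < \<alpha> i\<close>
  for some \<open>i \<notin> F\<close>.
\<close>

definition capped :: "nat set \<Rightarrow> 'a ordinal \<Rightarrow> (nat \<Rightarrow> 'a ordinal) \<Rightarrow> nat \<Rightarrow> 'a ordinal" where
  "capped F b \<alpha> = (\<lambda>j. if j \<in> F \<or> \<alpha> j \<le> b then \<alpha> j else b)"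

lemma left_moves_seq_game:
  "left_moves seq_game \<alpha> = {capped F b \<alpha> | i F b. finite F \<and> i \<notin> F \<and> b < \<alpha> i}"
  by (simp add: seq_game_def capped_def)

lemma capped_le: "capped F b \<alpha> j \<le> \<alpha> j"
  by (auto simp: capped_def)

text \<open>
  Capping at \<open>b \<ge> \<zeta>\<close> changes neither the threshold \<open>\<zeta>\<close> nor the set of elements \<open>\<ge> \<zeta>\<close>, hence not the
  case of the definition.  Elements above \<open>\<zeta>\<close> may drop to \<open>\<zeta>\<close>, but then contribute \<open>0\<close> outside
  \<open>limit_case\<close>, so the sum may still range over the old special elements.
\<close>

lemma cnf_sum_S_high_move:
  assumes "seq_zeta \<alpha> \<le> b"
  shows "cnf (sum_S (capped F b \<alpha>)) =
    main_exps \<alpha> + (\<Sum>i\<in>special \<alpha>. cnf (left_diff (special_base \<alpha>) (capped F b \<alpha> i)))"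
proof -
  let ?z = "seq_zeta \<alpha>" and ?\<beta> = "capped F b \<alpha>"
  have "seq_zeta ?\<beta> \<le> z \<longleftrightarrow> ?z \<le> z" for z
  proof (cases "?z \<le> z")
    case True
    then have "finite {i. z < \<alpha> i}" by (simp add: seq_zeta_le_iff)
    then have "finite {i. z < ?\<beta> i}"
      by (rule rev_finite_subset) (auto intro: less_le_trans capped_le)
    then show ?thesis using True by (simp add: seq_zeta_le_iff)
  next
    case False
    then have "z < b" using assms by simp
    then have "{i. z < ?\<beta> i} = {i. z < \<alpha> i}" by (auto simp: capped_def)
    then show ?thesis by (simp add: seq_zeta_le_iff)
  qed
  then have z: "seq_zeta ?\<beta> = ?z" by (simp add: eq_iff)
  have ge: "{i. ?z \<le> ?\<beta> i} = {i. ?z \<le> \<alpha> i}"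
    using assms by (auto simp: capped_def)
  have fl: "limit_case ?\<beta> \<longleftrightarrow> limit_case \<alpha>"
    by (simp add: limit_case_def z ge)
  have "(\<Sum>i\<in>special ?\<beta>. cnf (left_diff (special_base \<alpha>) (?\<beta> i))) =
      (\<Sum>i\<in>special \<alpha>. cnf (left_diff (special_base \<alpha>) (?\<beta> i)))"
  proof (cases "limit_case \<alpha>")
    case True
    then show ?thesis by (simp add: special_def fl z ge)
  next
    case False
    have "special ?\<beta> = {i. ?z < ?\<beta> i}" using False by (simp add: special_def fl z)
    moreover have "(\<Sum>i\<in>special \<alpha>. cnf (left_diff ?z (?\<beta> i))) =
      (\<Sum>i\<in>{i. ?z < ?\<beta> i}. cnf (left_diff ?z (?\<beta> i)))"
    proof (rule sum_left_diff_neutral)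
      show "{i. ?z < ?\<beta> i} \<subseteq> special \<alpha>"
        by (auto intro!: special_gt intro: less_le_trans capped_le)
      show "special \<alpha> \<subseteq> {i. ?z \<le> ?\<beta> i}"
        using special_ge ge by blast
    qed simp
    ultimately show ?thesis using False by (simp add: special_base_def)
  qed
  moreover have "main_exps ?\<beta> = main_exps \<alpha>" "special_base ?\<beta> = special_base \<alpha>"
    by (simp_all add: main_exps_def special_base_def fl z)
  ultimately show ?thesis by (simp add: cnf_sum_S)
qed

text \<open>
  For \<open>b < \<zeta>\<close> infinitely many elements are cut down to exactly \<open>b\<close>, and only elements of \<open>F\<close> stay
  above \<open>b\<close>.  So \<open>b\<close> is the new threshold and the new sequence is not in \<open>limit_case\<close>.
\<close>

lemma cnf_sum_S_low_move:
  assumes "b < seq_zeta \<alpha>" "finite F"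
  shows "cnf (sum_S (capped F b \<alpha>)) =
    shift (cnf b) + (\<Sum>i\<in>{i\<in>F. b < \<alpha> i}. cnf (left_diff b (\<alpha> i)))"
proof -
  let ?\<beta> = "capped F b \<alpha>"
  have inf: "infinite {i. b < \<alpha> i}" using assms(1) by (rule infinite_above_below_seq_zeta)
  have ge: "infinite {i. b \<le> ?\<beta> i}"
    by (rule infinite_super[OF _ inf]) (auto simp: capped_def)
  have "seq_zeta ?\<beta> \<le> z \<longleftrightarrow> b \<le> z" for z
  proof (cases "b \<le> z")
    case True
    have "finite {i. z < ?\<beta> i}"
      by (rule finite_subset[OF _ assms(2)]) (use True in \<open>auto simp: capped_def split: if_splits\<close>)
    then show ?thesis using True by (simp add: seq_zeta_le_iff)
  next
    case False
    then have "infinite {i. z < ?\<beta> i}"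
      by (intro infinite_super[OF _ ge]) auto
    then show ?thesis using False by (simp add: seq_zeta_le_iff)
  qed
  then have z: "seq_zeta ?\<beta> = b" by (simp add: eq_iff)
  have fl: "\<not> limit_case ?\<beta>" using ge by (simp add: limit_case_def z)
  have "special ?\<beta> = {i\<in>F. b < \<alpha> i}"
    unfolding special_def if_not_P[OF fl] z by (auto simp: capped_def)
  moreover have "?\<beta> i = \<alpha> i" if "i \<in> F" for i using that by (simp add: capped_def)
  ultimately show ?thesis
    using fl by (simp add: cnf_sum_S main_exps_def special_base_def z)
qed

lemma low_move_available:
  assumes "b < seq_zeta \<alpha>" "finite F"
  shows "capped F b \<alpha> \<in> left_moves seq_game \<alpha>"
proof -
  have "infinite ({i. b < \<alpha> i} - F)"
    using infinite_above_below_seq_zeta[OF assms(1)] assms(2) by (simp add: Diff_infinite_finite)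
  then obtain i where "i \<in> {i. b < \<alpha> i} - F" by (metis all_not_in_conv finite.emptyI)
  then show ?thesis using assms(2) unfolding left_moves_seq_game by blast
qed

lemma plus_absorb:
  assumes "x < omega_pow q" "omega_pow q \<le> (y :: 'a ordinal)"
  shows "x + y = y"
proof -
  obtain u where "y = omega_pow q + u" using assms(2) by (metis ordinal_plus_diff_ex)
  then show ?thesis using less_omega_pow_absorb[OF assms(1)] by (simp add: add.assoc[symmetric])
qed

text \<open>
  Passing from \<open>p + s\<close> to a smaller ordinal \<open>p + r\<close> whose tail is absorbed by \<open>s\<close> makes all of \<open>s\<close>
  reappear in the difference, independently of \<open>r\<close>.
\<close>

lemma left_diff_absorb:
  assumes "r + s = s" "p + s \<le> (a :: 'a ordinal)"
  shows "left_diff (p + r) a = s + left_diff (p + s) a"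
proof -
  have "(p + r) + (s + left_diff (p + s) a) = p + ((r + s) + left_diff (p + s) a)"
    by (simp only: add.assoc)
  also have "\<dots> = (p + s) + left_diff (p + s) a" by (simp only: assms(1) add.assoc)
  also have "\<dots> = a" using assms(2) by (rule plus_left_diff)
  finally show ?thesis using left_diff_unique by metis
qed

section \<open>Every option has a smaller sum\<close>

text \<open>
  Since \<open>i\<close> is special and not in \<open>F\<close>, its contribution strictly decreases, and no other one increases.
\<close>

lemma high_move_less:
  assumes "seq_zeta \<alpha> \<le> b" "b < \<alpha> i" "i \<notin> F"
  shows "sum_S (capped F b \<alpha>) < sum_S \<alpha>"
proof -
  let ?c = "special_base \<alpha>"
  have capped_ge: "?c \<le> capped F b \<alpha> j" if "j \<in> special \<alpha>" for j
    using special_ge[OF that] assms(1) special_base_le[of \<alpha>]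
    by (auto simp: capped_def intro: order_trans)
  have ge: "?c \<le> \<alpha> j" if "j \<in> special \<alpha>" for j
    using capped_ge[OF that] capped_le by (rule order_trans)
  have i: "i \<in> special \<alpha>" using assms(1,2) by (intro special_gt) simp
  have "(\<Sum>j\<in>special \<alpha>. cnf (left_diff ?c (capped F b \<alpha> j))) < (\<Sum>j\<in>special \<alpha>. cnf (left_diff ?c (\<alpha> j)))"
  proof (rule sum_strict_mono_ex1)
    show "\<forall>j\<in>special \<alpha>. cnf (left_diff ?c (capped F b \<alpha> j)) \<le> cnf (left_diff ?c (\<alpha> j))"
      using capped_ge ge by (simp add: capped_le cnf_le_iff left_diff_le_iff plus_left_diff)
    have "capped F b \<alpha> i < \<alpha> i" using assms(2,3) by (simp add: capped_def)
    then have "cnf (left_diff ?c (capped F b \<alpha> i)) < cnf (left_diff ?c (\<alpha> i))"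
      using capped_ge[OF i] ge[OF i] by (simp add: cnf_less_iff left_diff_less_iff plus_left_diff)
    then show "\<exists>j\<in>special \<alpha>. cnf (left_diff ?c (capped F b \<alpha> j)) < cnf (left_diff ?c (\<alpha> j))"
      using i by blast
  qed simp
  then have "cnf (sum_S (capped F b \<alpha>)) < cnf (sum_S \<alpha>)"
    unfolding cnf_sum_S_high_move[OF assms(1)] cnf_sum_S[of \<alpha>] by simp
  then show ?thesis by (simp add: cnf_less_iff)
qed

text \<open>
  See the introduction for the idea.  The two main cases are whether the main multiset contains
  \<open>q + 1\<close> beside \<open>shift P\<close> or only the limit exponent \<open>q\<close>.
\<close>

lemma low_move_less:
  assumes b: "b < seq_zeta \<alpha>" and F: "finite F"
  shows "sum_S (capped F b \<alpha>) < sum_S \<alpha>"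
proof -
  let ?z = "seq_zeta \<alpha>" and ?c = "special_base \<alpha>"
  obtain P q Q R where Z: "cnf ?z = P + add_mset q Q" and B: "cnf b = P + R"
    and P: "\<forall>p\<in>#P. q \<le> p" and Q: "\<forall>x\<in>#Q. x \<le> q" and R: "\<forall>r\<in>#R. r < q"
    using b by (auto simp flip: cnf_less_iff elim: multiset_less_split)
  define p where "p = of_cnf P"
  define r where "r = of_cnf R"
  define s where "s = of_cnf (add_mset q Q)"
  have z_eq: "?z = p + s"
  proof -
    have "of_cnf P + of_cnf (add_mset q Q) = of_cnf (P + add_mset q Q)"
      using P Q by (intro of_cnf_plus_prefix) (auto intro: order_trans)
    then show ?thesis by (simp only: p_def s_def Z[symmetric] of_cnf_cnf)
  qed
  have b_eq: "b = p + r"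
  proof -
    have "of_cnf P + of_cnf R = of_cnf (P + R)"
      using P R by (intro of_cnf_plus_prefix) (blast intro: less_imp_le less_le_trans)
    then show ?thesis by (simp only: p_def r_def B[symmetric] of_cnf_cnf)
  qed
  have "r < omega_pow q" unfolding r_def using R by (rule of_cnf_less_omega_pow)
  moreover have "omega_pow q \<le> s" unfolding s_def using Q by (simp add: of_cnf_add_max ordinal_le_plus_left)
  ultimately have rs: "r + s = s" by (rule plus_absorb)
  (* Both b and \<zeta> start with p, and the tail r of b is absorbed by the
     tail s of \<zeta>, so s bounds what is gained by subtracting b instead of \<zeta>. *)
  have above: "left_diff b a = s + left_diff ?z a" if "?z \<le> a" for a
    unfolding b_eq z_eq using rs that[unfolded z_eq] by (rule left_diff_absorb)
  have below: "left_diff b a < s" if "b \<le> a" "a < ?z" for a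
  proof -
    have "b + s = ?z" by (simp add: b_eq z_eq rs add.assoc)
    then show ?thesis using that by (simp add: left_diff_less_iff)
  qed
  define F' where "F' = {i\<in>F. b < \<alpha> i}"
  have fin: "finite F'" using F by (simp add: F'_def)
  have value_eq: "cnf (sum_S (capped F b \<alpha>)) = shift P + shift R + (\<Sum>i\<in>F'. cnf (left_diff b (\<alpha> i)))"
    using cnf_sum_S_low_move[OF b F] by (simp add: B F'_def)
  have "shift P + shift R + (\<Sum>i\<in>F'. cnf (left_diff b (\<alpha> i))) <
    main_exps \<alpha> + (\<Sum>i\<in>special \<alpha>. cnf (left_diff ?c (\<alpha> i)))"
  proof (cases "limit_case \<alpha> \<and> Q = {#}")
    case True
    then have pos: "?z \<noteq> 0" by (auto simp: limit_case_def)
    have cz: "cnf ?z = add_mset q P" using Z True by simp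
    have "last_exponent ?z \<le> q" using cnf_drop_last(2)[OF pos] unfolding cz by simp
    moreover have "last_exponent ?z \<in># add_mset q P"
      unfolding cz[symmetric] cnf_drop_last(1)[OF pos] by simp
    ultimately have "last_exponent ?z = q" using P by (auto intro: antisym)
    moreover from this have "cnf (drop_last ?z) = P"
      using cnf_drop_last(1)[OF pos] cz by simp
    ultimately have main: "main_exps \<alpha> = add_mset q (shift P)" and base: "?c = p"
      and lim: "is_limit q"
      using True of_cnf_cnf[of "drop_last ?z"]
      by (simp_all add: main_exps_def special_base_def p_def) (simp add: limit_case_def)
    define A where "A = {i\<in>F'. ?z \<le> \<alpha> i}"
    define N where "N = (\<Sum>i\<in>F' - A. cnf (left_diff b (\<alpha> i)))"
    have s: "s = omega_pow q" using True by (simp add: s_def)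
    have "(\<Sum>i\<in>F'. cnf (left_diff b (\<alpha> i))) = N + (\<Sum>i\<in>A. cnf (left_diff b (\<alpha> i)))"
      unfolding N_def A_def using fin by (intro sum.subset_diff) auto
    also have "(\<Sum>i\<in>A. cnf (left_diff b (\<alpha> i))) = (\<Sum>i\<in>A. cnf (left_diff p (\<alpha> i)))"
    proof (rule sum.cong)
      fix i assume "i \<in> A"
      then have "?z \<le> \<alpha> i" by (simp add: A_def)
      then show "cnf (left_diff b (\<alpha> i)) = cnf (left_diff p (\<alpha> i))"
        using above left_diff_absorb[of 0 s p "\<alpha> i"] by (simp add: z_eq)
    qed simp
    also have "(\<Sum>i\<in>A. cnf (left_diff p (\<alpha> i))) \<le> (\<Sum>i\<in>special \<alpha>. cnf (left_diff p (\<alpha> i)))"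
      using True by (intro sum_mono2 finite_special) (auto simp: A_def special_def)
    finally have le: "(\<Sum>i\<in>F'. cnf (left_diff b (\<alpha> i))) \<le>
        N + (\<Sum>i\<in>special \<alpha>. cnf (left_diff p (\<alpha> i)))" by simp
    have "\<forall>x\<in>#cnf (left_diff b (\<alpha> i)). x < q" if "i \<in> F' - A" for i
      using below[of "\<alpha> i"] that by (auto simp: A_def F'_def s not_le simp flip: less_omega_pow_iff)
    then have "\<forall>x\<in>#N. x < q"
      unfolding N_def using fin by (auto simp: set_mset_sum)
    then have "shift R + N < {#q#}"
      using R lim by (auto intro: is_limit_succ_less)
    then have "shift P + (shift R + N) + (\<Sum>i\<in>special \<alpha>. cnf (left_diff p (\<alpha> i))) <
      shift P + {#q#} + (\<Sum>i\<in>special \<alpha>. cnf (left_diff p (\<alpha> i)))"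
      by (intro add_strict_right_mono add_strict_left_mono)
    with add_left_mono[OF le, of "shift P + shift R"]
    have "shift P + shift R + (\<Sum>i\<in>F'. cnf (left_diff b (\<alpha> i))) <
        shift P + {#q#} + (\<Sum>i\<in>special \<alpha>. cnf (left_diff p (\<alpha> i)))"
      unfolding add.assoc by (rule le_less_trans)
    then show ?thesis by (simp add: main base)
  next
    case False
    (* K is what the main multiset has beside shift P. If \<zeta> loses its last
       exponent in limit_case, this exponent is a member of Q, so q survives. *)
    obtain K where main: "main_exps \<alpha> = shift P + K" and K: "q + 1 \<in># K"
    proof (cases "limit_case \<alpha>")
      case True
      then have pos: "?z \<noteq> 0" by (auto simp: limit_case_def)
      let ?x = "last_exponent ?z"
      from True False have "Q \<noteq> {#}" by simp
      then obtain y where y: "y \<in># Q" by blast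
      have "?x \<le> y" using cnf_drop_last(2)[OF pos] y by (simp add: Z)
      moreover have "y \<le> q" using y Q by simp
      moreover have "?x \<in># P + add_mset q Q"
        unfolding Z[symmetric] cnf_drop_last(1)[OF pos] by simp
      moreover have "q \<le> ?x" if "?x \<in># P" using that P by blast
      ultimately have "?x \<in># Q \<or> ?x = y" by auto
      with y have "?x \<in># Q" by auto
      then have "P + add_mset q Q = add_mset ?x (P + add_mset q (Q - {#?x#}))"
        by simp
      then have "add_mset ?x (cnf (drop_last ?z)) = add_mset ?x (P + add_mset q (Q - {#?x#}))"
        by (rule trans[OF trans[OF cnf_drop_last(1)[OF pos, symmetric] Z]])
      then have "cnf (drop_last ?z) = P + add_mset q (Q - {#?x#})"
        by (simp only: add_mset_add_mset_same_iff)
      then show ?thesis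
        using True by (intro that[of "add_mset ?x (shift (add_mset q (Q - {#?x#})))"])
          (simp_all add: main_exps_def)
    next
      case False
      then show ?thesis by (intro that[of "shift (add_mset q Q)"]) (simp_all add: main_exps_def Z)
    qed
    define e where "e i = (if ?z < \<alpha> i then cnf (left_diff ?z (\<alpha> i)) else {#})" for i
    define N where "N = (\<Sum>i\<in>F'. cnf s)"
    have "cnf (left_diff b (\<alpha> i)) \<le> cnf s + e i" if "i \<in> F'" for i
    proof (cases "?z < \<alpha> i")
      case True
      then show ?thesis using above[of "\<alpha> i"] by (simp add: e_def cnf_plus_le)
    next
      case False
      have "left_diff b (\<alpha> i) \<le> s"
      proof (cases "\<alpha> i = ?z")
        case True
        then show ?thesis using above[of ?z] left_diff_unique[of ?z 0] by simp
      next
        case False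
        then have "\<alpha> i < ?z" using \<open>\<not> ?z < \<alpha> i\<close> by simp
        then show ?thesis using below[of "\<alpha> i"] that by (simp add: F'_def less_imp_le)
      qed
      then show ?thesis using False by (simp add: e_def cnf_le_iff)
    qed
    then have "(\<Sum>i\<in>F'. cnf (left_diff b (\<alpha> i))) \<le> (\<Sum>i\<in>F'. cnf s + e i)"
      by (rule sum_mono)
    also have "\<dots> = N + sum e F'" by (simp add: sum.distrib N_def)
    also have "sum e F' = sum e (F' \<inter> {i. ?z < \<alpha> i})"
      using fin by (intro sum.mono_neutral_right) (auto simp: e_def)
    also have "\<dots> \<le> (\<Sum>i\<in>F' \<inter> {i. ?z < \<alpha> i}. cnf (left_diff ?c (\<alpha> i)))"
      by (rule sum_mono)
        (auto simp: e_def cnf_le_iff intro!: left_diff_antimono_left special_base_le)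
    also have "\<dots> \<le> (\<Sum>i\<in>special \<alpha>. cnf (left_diff ?c (\<alpha> i)))"
      by (intro sum_mono2) (auto intro: special_gt)
    finally have le: "(\<Sum>i\<in>F'. cnf (left_diff b (\<alpha> i))) \<le>
        N + (\<Sum>i\<in>special \<alpha>. cnf (left_diff ?c (\<alpha> i)))" by simp
    have "\<forall>x\<in>#N. x \<le> q"
      unfolding N_def using Q fin by (auto simp: set_mset_sum s_def)
    then have "shift R + N < K"
      using R K by (intro ex_gt_imp_less_multiset bexI exI[of _ "q + 1"])
        (auto simp: ordinal_less_succ_iff ordinal_succ_le_iff)
    then have "shift P + (shift R + N) + (\<Sum>i\<in>special \<alpha>. cnf (left_diff ?c (\<alpha> i))) <
      shift P + K + (\<Sum>i\<in>special \<alpha>. cnf (left_diff ?c (\<alpha> i)))"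
      by (intro add_strict_right_mono add_strict_left_mono)
    with add_left_mono[OF le, of "shift P + shift R"]
    have "shift P + shift R + (\<Sum>i\<in>F'. cnf (left_diff b (\<alpha> i))) <
        shift P + K + (\<Sum>i\<in>special \<alpha>. cnf (left_diff ?c (\<alpha> i)))"
      unfolding add.assoc by (rule le_less_trans)
    then show ?thesis by (simp add: main)
  qed
  then have "cnf (sum_S (capped F b \<alpha>)) < cnf (sum_S \<alpha>)"
    by (simp add: value_eq cnf_sum_S[of \<alpha>])
  then show ?thesis by (simp add: cnf_less_iff)
qed

lemma left_option_less:
  assumes "\<beta> \<in> left_moves seq_game \<alpha>"
  shows "sum_S \<beta> < sum_S \<alpha>"
proof -
  obtain i F b where "finite F" "i \<notin> F" "b < \<alpha> i" "\<beta> = capped F b \<alpha>"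
    using assms unfolding left_moves_seq_game by blast
  then show ?thesis
    using high_move_less low_move_less by (cases "seq_zeta \<alpha> \<le> b") (auto simp: not_le)
qed

section \<open>Every smaller ordinal is reached\<close>

text \<open>
  Lower the single special element \<open>j\<close> to \<open>special_base \<alpha> + d\<close> and protect all the other ones.
\<close>

lemma reach_high:
  assumes j: "j \<in> special \<alpha>" and d: "d < left_diff (special_base \<alpha>) (\<alpha> j)"
    and ge: "seq_zeta \<alpha> \<le> special_base \<alpha> + d"
  shows "\<exists>\<beta>\<in>left_moves seq_game \<alpha>. main_exps \<alpha> + cnf d +
    (\<Sum>i\<in>special \<alpha> - {j}. cnf (left_diff (special_base \<alpha>) (\<alpha> i))) \<le> cnf (sum_S \<beta>)"
proof -
  let ?c = "special_base \<alpha>" and ?b = "special_base \<alpha> + d" and ?F = "special \<alpha> - {j}"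
  let ?\<beta> = "capped ?F ?b \<alpha>"
  have "?c \<le> \<alpha> j" using special_base_le special_ge[OF j] by (rule order_trans)
  then have b: "?b < \<alpha> j"
    using ordinal_plus_strict_mono[OF d, of ?c] by (simp add: plus_left_diff)
  then have move: "?\<beta> \<in> left_moves seq_game \<alpha>"
    unfolding left_moves_seq_game by (intro CollectI exI[of _ j] exI[of _ ?F] exI[of _ ?b]) simp
  have "(\<Sum>i\<in>special \<alpha>. cnf (left_diff ?c (?\<beta> i))) =
      cnf (left_diff ?c (?\<beta> j)) + (\<Sum>i\<in>?F. cnf (left_diff ?c (?\<beta> i)))"
    using j by (intro sum.remove) simp_all
  also have "left_diff ?c (?\<beta> j) = d"

  proof -
    have "?\<beta> j = ?b" using b by (auto simp: capped_def)
    then show ?thesis by (simp add: left_diff_unique)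
  qed
  also have "(\<Sum>i\<in>?F. cnf (left_diff ?c (?\<beta> i))) = (\<Sum>i\<in>?F. cnf (left_diff ?c (\<alpha> i)))"
    by (rule sum.cong) (simp_all add: capped_def)
  finally have "cnf (sum_S ?\<beta>) = main_exps \<alpha> + cnf d + (\<Sum>i\<in>?F. cnf (left_diff ?c (\<alpha> i)))"
    using cnf_sum_S_high_move[OF ge, of ?F] by (simp add: ac_simps)
  with move show ?thesis by (intro bexI[of _ ?\<beta>]) simp_all
qed

text \<open>
  With the special elements as exception set, the low move at \<open>b\<close> keeps their contributions at
  least as large and replaces the main multiset by that of \<open>b \<otimes> \<omega>\<close>.
\<close>

lemma reach_low:
  assumes b: "b < seq_zeta \<alpha>"
    and le: "\<And>i. i \<in> special \<alpha> \<Longrightarrow> left_diff (special_base \<alpha>) (\<alpha> i) \<le> left_diff b (\<alpha> i)"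
  shows "\<exists>\<beta>\<in>left_moves seq_game \<alpha>.
    shift (cnf b) + (\<Sum>i\<in>special \<alpha>. cnf (left_diff (special_base \<alpha>) (\<alpha> i))) \<le> cnf (sum_S \<beta>)"
proof -
  have "{i\<in>special \<alpha>. b < \<alpha> i} = special \<alpha>"
    using special_ge b by (auto intro: less_le_trans)
  then have "cnf (sum_S (capped (special \<alpha>) b \<alpha>)) = shift (cnf b) + (\<Sum>i\<in>special \<alpha>. cnf (left_diff b (\<alpha> i)))"
    using cnf_sum_S_low_move[OF b finite_special[of \<alpha>]] by simp
  moreover have "(\<Sum>i\<in>special \<alpha>. cnf (left_diff (special_base \<alpha>) (\<alpha> i))) \<le> (\<Sum>i\<in>special \<alpha>. cnf (left_diff b (\<alpha> i)))"
    using le by (intro sum_mono) (simp add: cnf_le_iff)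
  ultimately show ?thesis
    using low_move_available[OF b finite_special] by (intro bexI[of _ "capped (special \<alpha>) b \<alpha>"]) simp_all
qed

text \<open>
  If infinitely many elements are at least \<open>p + \<omega>\<^bsup>q\<^esup>\<close>, exempting \<open>n\<close> of them from the cap at \<open>p\<close>
  contributes \<open>n\<close> copies of \<open>\<omega>\<^bsup>q\<^esup>\<close>.
\<close>

lemma reach_by_many:
  assumes p: "p \<le> special_base \<alpha>" and inf: "infinite {i. p + omega_pow q \<le> \<alpha> i}"
    and pq: "p + omega_pow q \<le> seq_zeta \<alpha>"
  shows "\<exists>\<beta>\<in>left_moves seq_game \<alpha>. shift (cnf p) + replicate_mset n q +
    (\<Sum>i\<in>special \<alpha>. cnf (left_diff (special_base \<alpha>) (\<alpha> i))) \<le> cnf (sum_S \<beta>)"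
proof -
  let ?c = "special_base \<alpha>"
  have lt: "p < p + omega_pow q" using ordinal_plus_strict_mono[OF omega_pow_pos, of p q] by simp
  then have b: "p < seq_zeta \<alpha>" using pq by simp
  have "infinite ({i. p + omega_pow q \<le> \<alpha> i} - special \<alpha>)"
    using inf by (simp add: Diff_infinite_finite)
  then obtain G where G: "finite G" "card G = n" "G \<subseteq> {i. p + omega_pow q \<le> \<alpha> i} - special \<alpha>"
    by (metis infinite_arbitrarily_large)
  let ?F = "special \<alpha> \<union> G"
  have fin: "finite ?F" using G(1) by simp
  have "p < \<alpha> i" if "i \<in> ?F" for i
    using that G(3) special_ge[of i \<alpha>] b lt by (auto intro: less_le_trans)
  then have "{i\<in>?F. p < \<alpha> i} = ?F" by blast
  then have "cnf (sum_S (capped ?F p \<alpha>)) = shift (cnf p) + (\<Sum>i\<in>?F. cnf (left_diff p (\<alpha> i)))"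
    using cnf_sum_S_low_move[OF b fin] by simp
  also have "(\<Sum>i\<in>?F. cnf (left_diff p (\<alpha> i))) =
      (\<Sum>i\<in>special \<alpha>. cnf (left_diff p (\<alpha> i))) + (\<Sum>i\<in>G. cnf (left_diff p (\<alpha> i)))"
    using G by (intro sum.union_disjoint) auto
  finally have val: "cnf (sum_S (capped ?F p \<alpha>)) = shift (cnf p) +
      ((\<Sum>i\<in>special \<alpha>. cnf (left_diff p (\<alpha> i))) + (\<Sum>i\<in>G. cnf (left_diff p (\<alpha> i))))" .
  have "left_diff ?c (\<alpha> i) \<le> left_diff p (\<alpha> i)" if "i \<in> special \<alpha>" for i
    using p order_trans[OF special_base_le special_ge[OF that]] by (rule left_diff_antimono_left)
  then have 1: "(\<Sum>i\<in>special \<alpha>. cnf (left_diff ?c (\<alpha> i))) \<le> (\<Sum>i\<in>special \<alpha>. cnf (left_diff p (\<alpha> i)))"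
    by (intro sum_mono) (simp add: cnf_le_iff)
  have "{#q#} \<le> cnf (left_diff p (\<alpha> i))" if "i \<in> G" for i
  proof -
    have *: "p + omega_pow q \<le> \<alpha> i" using that G(3) by blast
    then have "p \<le> \<alpha> i" using lt by simp
    then have "omega_pow q \<le> left_diff p (\<alpha> i)"
      using * left_diff_less_iff[of p "\<alpha> i" "omega_pow q"] by (simp flip: not_less)
    then show ?thesis by (simp flip: cnf_le_iff)
  qed
  then have "(\<Sum>i\<in>G. {#q#}) \<le> (\<Sum>i\<in>G. cnf (left_diff p (\<alpha> i)))" by (rule sum_mono)
  moreover have "(\<Sum>i\<in>G. {#q#}) = replicate_mset (card G) q"
    using G(1) by (induction G rule: finite_induct) simp_all
  ultimately have 2: "replicate_mset n q \<le> (\<Sum>i\<in>G. cnf (left_diff p (\<alpha> i)))" using G(2) by simp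
  have "shift (cnf p) + replicate_mset n q + (\<Sum>i\<in>special \<alpha>. cnf (left_diff ?c (\<alpha> i))) \<le>
      cnf (sum_S (capped ?F p \<alpha>))"
    using add_mono[OF 1 2] unfolding val by (simp add: ac_simps)
  with low_move_available[OF b fin] show ?thesis by blast
qed

text \<open>
  Here \<open>p\<close> consists of the exponents \<open>\<ge> q\<close> of \<open>u\<close> except for one copy of \<open>q\<close>.  All the other
  exponents are below \<open>q\<close>, so they are at most \<open>q\<close> after the shift and can be replaced by copies of
  \<open>q\<close>.
\<close>

lemma truncate_at_exponent:
  fixes u :: "'a ordinal"
  assumes q: "q \<in># cnf u" and Y: "\<forall>y\<in>#Y. y \<le> q"
  obtains p n where "shift (cnf u - {#q#}) + Y \<le> shift (cnf p) + replicate_mset n q"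
    "p \<le> u" "p + omega_pow q \<le> u" "\<forall>y\<in>#cnf p. q \<le> y"
proof -
  define P where "P = filter_mset (\<lambda>x. q \<le> x) (cnf u - {#q#})"
  define Q where "Q = filter_mset (\<lambda>x. \<not> q \<le> x) (cnf u - {#q#})"
  have part: "cnf u - {#q#} = P + Q" unfolding P_def Q_def by (rule multiset_partition)
  then have u: "cnf u = P + add_mset q Q" using q by (metis insert_DiffM union_mset_add_mset_right)
  have "of_cnf P + of_cnf (add_mset q Q) = of_cnf (P + add_mset q Q)"
    by (rule of_cnf_plus_prefix) (auto simp: P_def Q_def dest!: in_diffD)
  moreover have "of_cnf (add_mset q Q) = omega_pow q + of_cnf Q"
    by (rule of_cnf_add_max) (auto simp: Q_def)
  moreover have "of_cnf (P + add_mset q Q) = u" using of_cnf_cnf[of u] unfolding u .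
  ultimately have eq: "of_cnf P + omega_pow q + of_cnf Q = u" by (simp add: add.assoc)
  have "\<forall>y\<in>#shift Q + Y. y \<le> q"
    using Y by (auto simp: Q_def ordinal_succ_le_iff)
  then have "shift Q + Y \<le> replicate_mset (size (shift Q + Y)) q" by (rule le_replicate_mset)
  then have le: "shift (cnf u - {#q#}) + Y \<le>
      shift (cnf (of_cnf P)) + replicate_mset (size (shift Q + Y)) q"
    unfolding part by (simp add: add.assoc)
  show ?thesis
  proof (rule that[OF le])
    show "of_cnf P + omega_pow q \<le> u" using ordinal_le_plus_left eq by metis
    then show "of_cnf P \<le> u" using ordinal_le_plus_left order_trans by metis
    show "\<forall>y\<in>#cnf (of_cnf P). q \<le> y" by (auto simp: P_def dest!: in_diffD)
  qed
qed

text \<open>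
  There are three ways to approach the main multiset from below.  For the limit exponent \<open>x\<close>
  in \<open>limit_case\<close>, the threshold \<open>special_base \<alpha> + of_cnf Y\<close> works at once.  For \<open>x = q + 1\<close>, the goal
  is first enlarged to \<open>n\<close> copies of \<open>\<omega>\<^bsup>q\<^esup>\<close> beside \<open>shift (cnf p)\<close>.  These come from infinitely many
  elements \<open>\<ge> p + \<omega>\<^bsup>q\<^esup>\<close>, if there are any.  Otherwise \<open>p + \<omega>\<^bsup>q\<^esup> = \<zeta>\<close> and \<open>\<zeta>\<close> is reached only finitely
  often; this forces \<open>q\<close> to be a successor \<open>h + 1\<close>, and \<open>n\<close> copies of \<open>\<omega>\<^bsup>h\<^esup>\<close> in the threshold
  become \<open>n\<close> copies of \<open>\<omega>\<^bsup>q\<^esup>\<close> in the sum.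
\<close>

lemma reach_main:
  assumes x: "x \<in># main_exps \<alpha>" and Y: "\<forall>y\<in>#Y. y < x"
  shows "\<exists>\<beta>\<in>left_moves seq_game \<alpha>. (main_exps \<alpha> - {#x#}) + Y +
    (\<Sum>i\<in>special \<alpha>. cnf (left_diff (special_base \<alpha>) (\<alpha> i))) \<le> cnf (sum_S \<beta>)"
proof -
  let ?z = "seq_zeta \<alpha>" and ?c = "special_base \<alpha>"
  let ?D = "\<Sum>i\<in>special \<alpha>. cnf (left_diff ?c (\<alpha> i))"
  let ?x0 = "last_exponent ?z"
  have c_le: "?c \<le> \<alpha> i" if "i \<in> special \<alpha>" for i
    using special_base_le special_ge[OF that] by (rule order_trans)
  show ?thesis
  proof (cases "limit_case \<alpha> \<and> x = ?x0")
    case True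
    then have pos: "?z \<noteq> 0" by (auto simp: limit_case_def)
    have c: "?c = drop_last ?z" using True by (simp add: special_base_def)
    define r where "r = of_cnf Y"
    define b where "b = ?c + r"
    have r: "r < omega_pow ?x0" unfolding r_def using Y True by (intro of_cnf_less_omega_pow) simp
    then have b: "b < ?z"
      using drop_last_plus[OF pos] ordinal_plus_strict_mono[OF r, of ?c] by (simp add: b_def c)
    have "?c + of_cnf Y = of_cnf (cnf ?c + Y)"
      using of_cnf_plus_prefix[of "cnf ?c" Y] cnf_drop_last[OF pos] Y True
      by (fastforce simp: c)
    then have "cnf b = cnf ?c + Y" by (simp add: b_def r_def)
    then have "main_exps \<alpha> - {#x#} + Y \<le> shift (cnf b)"
      using True le_shift[of Y] by (simp add: main_exps_def c)
    moreover have "left_diff ?c (\<alpha> i) \<le> left_diff b (\<alpha> i)" if "i \<in> special \<alpha>" for i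
    proof -
      let ?s = "omega_pow ?x0"
      have s: "r + ?s = ?s" "?c + ?s \<le> \<alpha> i"
        using less_omega_pow_absorb[OF r] special_ge[OF that] drop_last_plus[OF pos] by (simp_all add: c)
      have "left_diff b (\<alpha> i) = left_diff (?c + 0) (\<alpha> i)"
        unfolding b_def using left_diff_absorb[OF s] left_diff_absorb[OF _ s(2), of 0] by simp
      then show ?thesis by simp
    qed
    then obtain \<beta> where "\<beta> \<in> left_moves seq_game \<alpha>" "shift (cnf b) + ?D \<le> cnf (sum_S \<beta>)"
      using reach_low[OF b] by blast
    ultimately show ?thesis by (meson add_right_mono order_trans)
  next
    case False
    have "x \<in># shift (cnf ?c)"
      using x False by (auto simp: main_exps_def special_base_def split: if_splits)
    then obtain q where q: "q \<in># cnf ?c" and xq: "x = q + 1" by auto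
    have diff: "shift (cnf ?c) - {#x#} = shift (cnf ?c - {#q#})"
      using q by (simp add: xq image_mset_Diff)
    obtain Y' where Y': "main_exps \<alpha> - {#x#} + Y = shift (cnf ?c - {#q#}) + Y'" "\<forall>y\<in>#Y'. y \<le> q"
    proof (cases "limit_case \<alpha>")
      case True
      then have pos: "?z \<noteq> 0" by (auto simp: limit_case_def)
      have "main_exps \<alpha> = add_mset ?x0 (shift (cnf ?c))"
        using True by (simp add: main_exps_def special_base_def)
      then have "main_exps \<alpha> - {#x#} = add_mset ?x0 (shift (cnf ?c - {#q#}))"
        using diff_union_swap[of x ?x0 "shift (cnf ?c)"] diff False True by simp
      moreover have "?x0 \<le> q"
        using cnf_drop_last[OF pos] q True by (simp add: special_base_def)
      ultimately show ?thesis
        using Y xq by (intro that[of "add_mset ?x0 Y"]) (auto simp: ordinal_less_succ_iff)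
    next
      case False
      then have "main_exps \<alpha> = shift (cnf ?c)"
        by (simp add: main_exps_def special_base_def)
      then show ?thesis
        using Y xq diff by (intro that[of Y]) (auto simp: ordinal_less_succ_iff)
    qed
    obtain p n where le: "shift (cnf ?c - {#q#}) + Y' \<le> shift (cnf p) + replicate_mset n q"
      and p: "p \<le> ?c" "p + omega_pow q \<le> ?c" "\<forall>y\<in>#cnf p. q \<le> y"
      using truncate_at_exponent[OF q Y'(2)] by blast
    have pz: "p + omega_pow q \<le> ?z" using p(2) special_base_le by (rule order_trans)
    have target: ?thesis if "\<exists>\<beta>\<in>left_moves seq_game \<alpha>.
        shift (cnf p) + replicate_mset n q + ?D \<le> cnf (sum_S \<beta>)"
      using that add_right_mono[OF le, of ?D] unfolding Y'(1) by (meson order_trans)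
    show ?thesis
    proof (cases "infinite {i. p + omega_pow q \<le> \<alpha> i}")
      case True
      then show ?thesis using reach_by_many[OF p(1) _ pz] target by blast
    next
      case fin: False
      have "\<not> p + omega_pow q < ?z"
      proof
        assume "p + omega_pow q < ?z"
        then have "infinite {i. p + omega_pow q < \<alpha> i}" by (rule infinite_above_below_seq_zeta)
        moreover have "{i. p + omega_pow q < \<alpha> i} \<subseteq> {i. p + omega_pow q \<le> \<alpha> i}" by auto
        ultimately show False using fin by (auto dest: finite_subset)
      qed
      with pz have z: "p + omega_pow q = ?z" by simp
      then have c: "?c = ?z" using p(2) special_base_le[of \<alpha>] by simp
      have fz: "finite {i. ?z \<le> \<alpha> i}" using fin by (simp add: z)
      have pos: "?z \<noteq> 0" using q c by auto
      have "cnf ?z = cnf p + {#q#}"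
        using of_cnf_plus_prefix[of "cnf p" "{#q#}"] p(3) by (simp add: z)
      then have x0: "?x0 = q"
        using p(3) by (auto simp: last_exponent_def intro: Min_eqI)
      have "\<not> limit_case \<alpha>"
      proof
        assume "limit_case \<alpha>"
        then have "cnf ?z = add_mset ?x0 (cnf ?z)"
          using cnf_drop_last(1)[OF pos] c by (simp add: special_base_def)
        then show False by simp
      qed
      then have "\<not> is_limit q"
        using fz pos x0 by (simp add: limit_case_def ordinal_zero_less_iff)
      moreover have "q \<noteq> 0"
      proof
        (* Then \<zeta> = p + 1, and infinitely many elements above p
           means infinitely many elements reaching \<zeta>. *)
        assume "q = 0"
        then have z: "?z = p + 1" using z by (simp add: omega_pow_zero)
        then have "infinite {i. p < \<alpha> i}"
          by (intro infinite_above_below_seq_zeta) (simp add: ordinal_less_succ_iff)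
        with fz show False by (simp add: z ordinal_succ_le_iff)
      qed
      ultimately obtain h where h: "q = h + 1" by (auto simp: is_limit_def)
      then have hq: "h < q" by (simp add: ordinal_less_succ_iff)
      define r where "r = of_cnf (replicate_mset n h)"
      have "r < omega_pow q"
        unfolding r_def using hq by (intro of_cnf_less_omega_pow) simp
      then have b: "p + r < ?z" by (simp flip: z)
      have "p + r = of_cnf (cnf p + replicate_mset n h)"
      proof -
        have "h \<le> y" if "y \<in># cnf p" for y using p(3) hq that by (blast intro: less_imp_le less_le_trans)
        then show ?thesis
          using of_cnf_plus_prefix[of "cnf p" "replicate_mset n h"] by (simp add: r_def)
      qed
      then have "shift (cnf (p + r)) = shift (cnf p) + replicate_mset n q"
        by (simp add: h)
      moreover have "left_diff ?c (\<alpha> i) \<le> left_diff (p + r) (\<alpha> i)" if "i \<in> special \<alpha>" for i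
        using b c_le[OF that] by (intro left_diff_antimono_left) (simp_all add: c)
      then have "\<exists>\<beta>\<in>left_moves seq_game \<alpha>. shift (cnf (p + r)) + ?D \<le> cnf (sum_S \<beta>)"
        using reach_low[OF b] by blast
      ultimately show ?thesis using target by simp
    qed
  qed
qed

text \<open>
  An exponent \<open>x\<close> that occurs in the main multiset is treated there, even if it also occurs in the
  contribution of a special element.  This leaves out precisely the special elements equal to \<open>\<zeta>\<close>
  in \<open>limit_case\<close>, whose only exponent is that of the main term \<open>\<omega>\<^bsup>\<xi>\<^esup>\<close> and which cannot be lowered
  without going below \<open>\<zeta>\<close>.
\<close>

lemma reach_all:
  assumes "c < sum_S \<alpha>"
  shows "\<exists>\<beta>\<in>left_moves seq_game \<alpha>. c \<le> sum_S \<beta>"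
proof -
  let ?z = "seq_zeta \<alpha>" and ?c = "special_base \<alpha>"
  let ?x0 = "last_exponent ?z"
  let ?D = "\<lambda>i. cnf (left_diff ?c (\<alpha> i))"
  have "cnf c < main_exps \<alpha> + sum ?D (special \<alpha>)"
    using assms by (simp add: cnf_less_iff flip: cnf_sum_S)
  then obtain x Y where x: "x \<in># main_exps \<alpha> + sum ?D (special \<alpha>)" and Y: "\<forall>y\<in>#Y. y < x"
    and le: "cnf c \<le> main_exps \<alpha> + sum ?D (special \<alpha>) - {#x#} + Y"
    by (rule multiset_less_replace_one)
  have "\<exists>\<beta>\<in>left_moves seq_game \<alpha>. cnf c \<le> cnf (sum_S \<beta>)"
  proof (cases "x \<in># main_exps \<alpha>")
    case True
    then have "main_exps \<alpha> + sum ?D (special \<alpha>) - {#x#} + Y = main_exps \<alpha> - {#x#} + Y + sum ?D (special \<alpha>)"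
      by (simp add: ac_simps)
    with reach_main[OF True Y] le show ?thesis by (metis order_trans)
  next
    case False
    with x have "x \<in># sum ?D (special \<alpha>)" by simp
    then obtain j where j: "j \<in> special \<alpha>" "x \<in># ?D j"
      by (auto simp: set_mset_sum)
    have c_j: "?c \<le> \<alpha> j" using special_base_le special_ge[OF j(1)] by (rule order_trans)
    define d0 where "d0 = of_cnf (?D j - {#x#} + Y)"
    have "?D j - {#x#} + Y < ?D j"
      using j(2) Y by (intro union_le_diff_plus) simp_all
    then have d0: "d0 < left_diff ?c (\<alpha> j)" by (simp add: d0_def flip: cnf_less_iff)
    (* In the limit case the tail d0 alone may lead below \<zeta>, in which case
       the move to \<zeta> itself is large enough. *)
    obtain d where d: "d0 \<le> d" "d < left_diff ?c (\<alpha> j)" "?z \<le> ?c + d"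
    proof (cases "limit_case \<alpha>")
      case True
      then have pos: "?z \<noteq> 0" by (auto simp: limit_case_def)
      have z: "?c + omega_pow ?x0 = ?z" using True drop_last_plus[OF pos] by (simp add: special_base_def)
      have "?c + omega_pow ?x0 \<le> ?c + left_diff ?c (\<alpha> j)"
        using special_ge[OF j(1)] c_j by (simp only: z plus_left_diff)
      then have "omega_pow ?x0 \<le> left_diff ?c (\<alpha> j)" by simp
      moreover have "omega_pow ?x0 \<noteq> left_diff ?c (\<alpha> j)"
      proof
        assume "omega_pow ?x0 = left_diff ?c (\<alpha> j)"
        then have "?D j = {#?x0#}" by (simp flip: cnf_omega_pow)
        then have "x = ?x0" using j(2) by simp
        then show False using False True by (simp add: main_exps_def)
      qed
      ultimately have "omega_pow ?x0 < left_diff ?c (\<alpha> j)" by simp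
      moreover have "?c + omega_pow ?x0 \<le> ?c + max d0 (omega_pow ?x0)" by simp
      then have "?z \<le> ?c + max d0 (omega_pow ?x0)" by (simp only: z)
      ultimately show ?thesis using d0 by (intro that[of "max d0 (omega_pow ?x0)"]) simp_all
    next
      case False
      then show ?thesis
        using d0 by (intro that[of d0]) (simp_all add: special_base_def ordinal_le_plus_left)
    qed
    have "sum ?D (special \<alpha>) = ?D j + sum ?D (special \<alpha> - {j})"
      using j(1) by (intro sum.remove) simp_all
    then have "main_exps \<alpha> + sum ?D (special \<alpha>) - {#x#} + Y =
        main_exps \<alpha> + (?D j - {#x#} + Y) + sum ?D (special \<alpha> - {j})"
      using j(2) by (simp add: ac_simps)
    also have "\<dots> \<le> main_exps \<alpha> + cnf d + sum ?D (special \<alpha> - {j})"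
      using d(1) by (simp add: d0_def flip: cnf_le_iff)
    finally show ?thesis
      using reach_high[OF j(1) d(2,3)] le by (meson order_trans)
  qed
  then show ?thesis by (simp add: cnf_le_iff)
qed

section \<open>The value of the game\<close>

lemma conway_le_ordinal_mono:
  assumes "conway_le ordinal_game G \<delta> p" "\<gamma> \<le> \<delta>" "right_moves G p = {}"
  shows "conway_le ordinal_game G (\<gamma> :: 'a ordinal) p"
  using assms by (auto simp: conway_le.simps[of ordinal_game])

text \<open>
  When Right cannot move, comparing a game with an ordinal only involves the options of Left, and the
  two inequalities of Conway equivalence are the two conditions of a least strict upper bound.
\<close>

lemma has_value_if_mex:
  fixes v :: "'p \<Rightarrow> 'a ordinal"
  assumes wf: "no_infinite_run G" and right: "\<And>p. right_moves G p = {}"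
    and less: "\<And>p p'. p' \<in> left_moves G p \<Longrightarrow> v p' < v p"
    and reach: "\<And>p c. c < v p \<Longrightarrow> \<exists>p'\<in>left_moves G p. c \<le> v p'"
  shows "has_value G p (v p)"
  using wf unfolding no_infinite_run_def
proof (induction p rule: wf_induct_rule)
  case (less p)
  have IH: "conway_le G ordinal_game p' (v p')" "conway_le ordinal_game G (v p') p'"
    if "p' \<in> left_moves G p" for p'
    using less that by (auto simp: has_value_def conway_eq_def)
  have "conway_le G ordinal_game p (v p)"
    using IH(1) assms(3) by (intro conway_le_conway_lf.le) (auto intro!: lf_left)
  moreover have "conway_le ordinal_game G (v p) p"
  proof (rule conway_le_conway_lf.le)
    show "\<forall>c\<in>left_moves ordinal_game (v p). conway_lf ordinal_game G c p"
    proof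
      fix c assume "c \<in> left_moves ordinal_game (v p)"
      then obtain p' where "p' \<in> left_moves G p" "c \<le> v p'" using reach by auto
      then show "conway_lf ordinal_game G c p"
        using IH(2) conway_le_ordinal_mono[OF _ _ right] lf_left by metis
    qed
  qed (simp add: right)
  ultimately show ?case by (simp add: has_value_def conway_eq_def)
qed

theorem theorem7p3:
  fixes \<alpha> :: "nat \<Rightarrow> 'a ordinal"
  shows "has_value seq_game \<alpha> (sum_S \<alpha>)"
proof (rule has_value_if_mex[OF no_infinite_run_seq_game])
  show "right_moves seq_game \<alpha> = {}" for \<alpha> :: "nat \<Rightarrow> 'a ordinal"
    by (simp add: seq_game_def)
qed (fact left_option_less reach_all)+

end
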